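(* Let $\mathcal{M}$ be an $\mathcal{L}$-structure smoothly approximated by finite homogeneous substructures $(\mathcal{M}_i)_{i<\omega}$. Then there exists a set $R$ of functions from $\mathcal{C}:=\{\mathcal{M}_i:i<\omega\}$ to $\mathbb{N}$ such that $\mathcal{C}$ is an $R$-mec in $\mathcal{L}$.
   Context: Languages are finitary and first-order. The underlying set of $\mathcal{M}$ is $M$, and $l(\bar{x})$ is the length of a tuple. For a formula $\varphi(\bar{x},\bar{y})$ with $n=l(\bar{x})$, $\varphi(\mathcal{M}^n,\bar{a})=\{\bar{c}\in M^n:\mathcal{M}\models\varphi(\bar{c},\bar{a})\}$. Smooth approximation. Let $\mathcal{M},\mathcal{N}$ be $\mathcal{L}$-structures. $\mathcal{N}$ is a homogeneous substructure of $\mathcal{M}$ (a single term) if $\mathcal{N}$ is an $\mathcal{L}$-substructure of $\mathcal{M}$ and for every $k\geq 1$ and every pair $\bar{a},\bar{b}\in N^k$, $\bar{a}$ and $\bar{b}$ lie in the same $\mathrm{Aut}(\mathcal{M})$-orbit if and only if they lie in the same $\mathrm{Aut}_{\{N\}}(\mathcal{M})$-orbit, where $\mathrm{Aut}_{\{N\}}(\mathcal{M}):=\{\sigma\in\mathrm{Aut}(\mathcal{M}):\sigma(N)=N\}$. An $\mathcal{L}$-structure $\mathcal{M}$ is smoothly approximated by $(\mathcal{M}_i)_{i<\omega}$ if $\mathcal{M}$ is $\aleph_0$-categorical, each $\mathcal{M}_i$ is a finite homogeneous substructure of $\mathcal{M}$, $M_i\subset M_{i+1}$ for all $i<\omega$,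 and $\bigcup_{i<\omega}M_i=M$. $R$-mec. Let $\mathcal{C}$ be a class of finite $\mathcal{L}$-structures. For $m\geq 1$ put $\mathcal{C}(m):=\{(\mathcal{M},\bar{a}):\mathcal{M}\in\mathcal{C},\ \bar{a}\in M^m\}$, and $\mathcal{C}(0):=\mathcal{C}$. A partition $\Phi$ of $\mathcal{C}(m)$ is definable if for every $\pi\in\Phi$ there is a parameter-free $\mathcal{L}$-formula $\psi(\bar{y})$ with $l(\bar{y})=m$ such that for every $(\mathcal{M},\bar{a})\in\mathcal{C}(m)$, $(\mathcal{M},\bar{a})\in\pi$ if and only if $\mathcal{M}\models\psi(\bar{a})$. For a set $R$ of functions from $\mathcal{C}$ to $\mathbb{N}$, $\mathcal{C}$ is an $R$-mec in $\mathcal{L}$ if for every parameter-free $\mathcal{L}$-formula $\varphi(\bar{x},\bar{y})$, with $n:=l(\bar{x})\geq 1$ and $m:=l(\bar{y})$, there is a finite definable partition $\Phi$ of $\mathcal{C}(m)$ such that for each $\pi\in\Phi$ there exists $h_\pi\in R$ with $|\varphi(\mathcal{M}^n,\bar{a})|=h_\pi(\mathcal{M})$ for all $(\mathcal{M},\bar{a})\in\pi$.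
   Formalization: The language is assumed countable; for uncountable languages the claim fails: name all relations on ω and take M_i={0,…,i}; Aut(M) is trivial and the countable model is unique, but x<y takes i+1 different counts on M_i. *)

theory Defs
  imports Main "HOL-Library.FuncSet" "HOL-Library.Countable_Set" "HOL-Library.Disjoint_Sets"
begin

section \<open>Languages and structures\<close>

text \<open>Symbols are drawn from carrier sets, so a language may lack function symbols or relation
  symbols altogether. Constants are function symbols of arity 0.\<close>

record ('f, 'r) lang =
  funs :: "'f set"
  rels :: "'r set"
  farity :: "'f \<Rightarrow> nat"
  rarity :: "'r \<Rightarrow> nat"

record ('f, 'r, 'a) struct =
  univ :: "'a set"
  fint :: "'f \<Rightarrow> 'a list \<Rightarrow> 'a"
  rint :: "'r \<Rightarrow> 'a list set"

definition tuples :: "nat \<Rightarrow> 'a set \<Rightarrow> 'a list set" where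
  "tuples n A = {xs. length xs = n \<and> set xs \<subseteq> A}"

text \<open>Interpretations are extensional, so that equality of records is equality of
  \<open>L\<close>-structures.\<close>

definition is_struct :: "('f, 'r) lang \<Rightarrow> ('f, 'r, 'a) struct \<Rightarrow> bool" where
  "is_struct L M \<longleftrightarrow>
     univ M \<noteq> {} \<and>
     fint M \<in> (\<Pi>\<^sub>E f\<in>funs L. tuples (farity L f) (univ M) \<rightarrow>\<^sub>E univ M) \<and>
     rint M \<in> (\<Pi>\<^sub>E r\<in>rels L. Pow (tuples (rarity L r) (univ M)))"

definition substruct :: "('f, 'r) lang \<Rightarrow> ('f, 'r, 'a) struct \<Rightarrow> ('f, 'r, 'a) struct \<Rightarrow> bool" where
  "substruct L N M \<longleftrightarrow>
     is_struct L N \<and> is_struct L M \<and> univ N \<subseteq> univ M \<and>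
     (\<forall>f\<in>funs L. \<forall>xs\<in>tuples (farity L f) (univ N). fint N f xs = fint M f xs) \<and>
     (\<forall>r\<in>rels L. \<forall>xs\<in>tuples (rarity L r) (univ N). xs \<in> rint N r \<longleftrightarrow> xs \<in> rint M r)"

definition isomorphism ::
  "('f, 'r) lang \<Rightarrow> ('f, 'r, 'a) struct \<Rightarrow> ('f, 'r, 'b) struct \<Rightarrow> ('a \<Rightarrow> 'b) \<Rightarrow> bool" where
  "isomorphism L M N g \<longleftrightarrow>
     bij_betw g (univ M) (univ N) \<and>
     (\<forall>f\<in>funs L. \<forall>xs\<in>tuples (farity L f) (univ M). g (fint M f xs) = fint N f (map g xs)) \<and>
     (\<forall>r\<in>rels L. \<forall>xs\<in>tuples (rarity L r) (univ M). xs \<in> rint M r \<longleftrightarrow> map g xs \<in> rint N r)"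

definition isomorphic :: "('f, 'r) lang \<Rightarrow> ('f, 'r, 'a) struct \<Rightarrow> ('f, 'r, 'b) struct \<Rightarrow> bool" where
  "isomorphic L M N \<longleftrightarrow> (\<exists>g. isomorphism L M N g)"


section \<open>Formulas and satisfaction\<close>

text \<open>De Bruijn indices: \<open>Exists \<phi>\<close> binds index 0 of \<open>\<phi>\<close>.\<close>

datatype 'f trm = Var nat | Fn 'f "'f trm list"

datatype ('f, 'r) fm =
    Eq "'f trm" "'f trm"
  | Rel 'r "'f trm list"
  | Neg "('f, 'r) fm"
  | Conj "('f, 'r) fm" "('f, 'r) fm"
  | Exists "('f, 'r) fm"

text \<open>\<open>is_fm L n \<phi>\<close>: \<open>\<phi>\<close> is a (parameter-free) \<open>L\<close>-formula with free variables among the indices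
  \<open>0, \<dots>, n - 1\<close>.\<close>

fun is_trm :: "('f, 'r) lang \<Rightarrow> nat \<Rightarrow> 'f trm \<Rightarrow> bool" where
  "is_trm L n (Var i) \<longleftrightarrow> i < n"
| "is_trm L n (Fn f ts) \<longleftrightarrow> f \<in> funs L \<and> length ts = farity L f \<and> (\<forall>t\<in>set ts. is_trm L n t)"

fun is_fm :: "('f, 'r) lang \<Rightarrow> nat \<Rightarrow> ('f, 'r) fm \<Rightarrow> bool" where
  "is_fm L n (Eq s t) \<longleftrightarrow> is_trm L n s \<and> is_trm L n t"
| "is_fm L n (Rel r ts) \<longleftrightarrow> r \<in> rels L \<and> length ts = rarity L r \<and> (\<forall>t\<in>set ts. is_trm L n t)"
| "is_fm L n (Neg \<phi>) \<longleftrightarrow> is_fm L n \<phi>"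
| "is_fm L n (Conj \<phi> \<psi>) \<longleftrightarrow> is_fm L n \<phi> \<and> is_fm L n \<psi>"
| "is_fm L n (Exists \<phi>) \<longleftrightarrow> is_fm L (Suc n) \<phi>"

primrec trm_val :: "('f, 'r, 'a) struct \<Rightarrow> (nat \<Rightarrow> 'a) \<Rightarrow> 'f trm \<Rightarrow> 'a" where
  "trm_val M e (Var i) = e i"
| "trm_val M e (Fn f ts) = fint M f (map (trm_val M e) ts)"

primrec sat :: "('f, 'r, 'a) struct \<Rightarrow> (nat \<Rightarrow> 'a) \<Rightarrow> ('f, 'r) fm \<Rightarrow> bool" where
  "sat M e (Eq s t) \<longleftrightarrow> trm_val M e s = trm_val M e t"
| "sat M e (Rel r ts) \<longleftrightarrow> map (trm_val M e) ts \<in> rint M r"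
| "sat M e (Neg \<phi>) \<longleftrightarrow> \<not> sat M e \<phi>"
| "sat M e (Conj \<phi> \<psi>) \<longleftrightarrow> sat M e \<phi> \<and> sat M e \<psi>"
| "sat M e (Exists \<phi>) \<longleftrightarrow> (\<exists>x\<in>univ M. sat M (case_nat x e) \<phi>)"

text \<open>\<open>holds M \<phi> as\<close> is \<open>M \<Turnstile> \<phi>(as)\<close>; it is meaningful when \<open>is_fm L (length as) \<phi>\<close>, as the
  values of \<open>(!) as\<close> beyond the length of \<open>as\<close> are then irrelevant.\<close>

definition holds :: "('f, 'r, 'a) struct \<Rightarrow> ('f, 'r) fm \<Rightarrow> 'a list \<Rightarrow> bool" where
  "holds M \<phi> as \<longleftrightarrow> sat M ((!) as) \<phi>"

text \<open>For \<open>\<phi>(x, y)\<close> the tuple \<open>x\<close> occupies the indices \<open>0, \<dots>, n - 1\<close> and \<open>y\<close> the following ones.\<close>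

definition solutions :: "('f, 'r) fm \<Rightarrow> ('f, 'r, 'a) struct \<Rightarrow> nat \<Rightarrow> 'a list \<Rightarrow> 'a list set" where
  "solutions \<phi> M n as = {cs \<in> tuples n (univ M). holds M \<phi> (cs @ as)}"


section \<open>Countable categoricity\<close>

definition Th :: "('f, 'r) lang \<Rightarrow> ('f, 'r, 'a) struct \<Rightarrow> ('f, 'r) fm set" where
  "Th L M = {\<phi>. is_fm L 0 \<phi> \<and> holds M \<phi> []}"

definition is_model :: "('f, 'r) lang \<Rightarrow> ('f, 'r) fm set \<Rightarrow> ('f, 'r, 'a) struct \<Rightarrow> bool" where
  "is_model L T A \<longleftrightarrow> is_struct L A \<and> (\<forall>\<phi>\<in>T. holds A \<phi> [])"

text \<open>\<open>Th L M\<close> has exactly one countably infinite model up to isomorphism. Every countably infinite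
  structure is isomorphic to one whose universe is a set of natural numbers, so it suffices to
  quantify over the latter.\<close>

definition aleph0_categorical :: "('f, 'r) lang \<Rightarrow> ('f, 'r, 'a) struct \<Rightarrow> bool" where
  "aleph0_categorical L M \<longleftrightarrow>
     is_struct L M \<and>
     (\<exists>A :: ('f, 'r, nat) struct. is_model L (Th L M) A \<and> infinite (univ A)) \<and>
     (\<forall>(A :: ('f, 'r, nat) struct) (B :: ('f, 'r, nat) struct).
        is_model L (Th L M) A \<and> infinite (univ A) \<and> is_model L (Th L M) B \<and> infinite (univ B)
        \<longrightarrow> isomorphic L A B)"


section \<open>Smooth approximation\<close>

definition Aut :: "('f, 'r) lang \<Rightarrow> ('f, 'r, 'a) struct \<Rightarrow> ('a \<Rightarrow> 'a) set" where
  "Aut L M = {\<sigma>. isomorphism L M M \<sigma>}"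

definition Aut_setwise :: "('f, 'r) lang \<Rightarrow> ('f, 'r, 'a) struct \<Rightarrow> 'a set \<Rightarrow> ('a \<Rightarrow> 'a) set" where
  "Aut_setwise L M N = {\<sigma> \<in> Aut L M. \<sigma> ` N = N}"

definition same_orbit :: "('a \<Rightarrow> 'a) set \<Rightarrow> 'a list \<Rightarrow> 'a list \<Rightarrow> bool" where
  "same_orbit G as bs \<longleftrightarrow> (\<exists>\<sigma>\<in>G. map \<sigma> as = bs)"

definition homogeneous_substruct ::
  "('f, 'r) lang \<Rightarrow> ('f, 'r, 'a) struct \<Rightarrow> ('f, 'r, 'a) struct \<Rightarrow> bool" where
  "homogeneous_substruct L N M \<longleftrightarrow>
     substruct L N M \<and>
     (\<forall>k\<ge>1. \<forall>as\<in>tuples k (univ N). \<forall>bs\<in>tuples k (univ N).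
        same_orbit (Aut L M) as bs \<longleftrightarrow> same_orbit (Aut_setwise L M (univ N)) as bs)"

definition smoothly_approximated ::
  "('f, 'r) lang \<Rightarrow> ('f, 'r, 'a) struct \<Rightarrow> (nat \<Rightarrow> ('f, 'r, 'a) struct) \<Rightarrow> bool" where
  "smoothly_approximated L M Ms \<longleftrightarrow>
     aleph0_categorical L M \<and>
     (\<forall>i. finite (univ (Ms i)) \<and> homogeneous_substruct L (Ms i) M) \<and>
     (\<forall>i. univ (Ms i) \<subseteq> univ (Ms (Suc i))) \<and>
     (\<Union>i. univ (Ms i)) = univ M"


section \<open>Multidimensional exact classes\<close>

text \<open>For \<open>m = 0\<close> this is the class itself, each \<open>M\<close> being paired with the empty tuple.\<close>

definition pointed :: "('f, 'r, 'a) struct set \<Rightarrow> nat \<Rightarrow> (('f, 'r, 'a) struct \<times> 'a list) set" where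
  "pointed C m = (SIGMA M:C. tuples m (univ M))"

definition definable_partition ::
  "('f, 'r) lang \<Rightarrow> ('f, 'r, 'a) struct set \<Rightarrow> nat \<Rightarrow>
     (('f, 'r, 'a) struct \<times> 'a list) set set \<Rightarrow> bool" where
  "definable_partition L C m \<Phi> \<longleftrightarrow>
     partition_on (pointed C m) \<Phi> \<and>
     (\<forall>\<pi>\<in>\<Phi>. \<exists>\<psi>. is_fm L m \<psi> \<and> (\<forall>(M, as)\<in>pointed C m. (M, as) \<in> \<pi> \<longleftrightarrow> holds M \<psi> as))"

definition is_mec ::
  "('f, 'r) lang \<Rightarrow> ('f, 'r, 'a) struct set \<Rightarrow> (('f, 'r, 'a) struct \<Rightarrow> nat) set \<Rightarrow> bool" where
  "is_mec L C R \<longleftrightarrow>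
     (\<forall>M\<in>C. is_struct L M \<and> finite (univ M)) \<and>
     (\<forall>n m \<phi>. 1 \<le> n \<and> is_fm L (n + m) \<phi> \<longrightarrow>
        (\<exists>\<Phi>. finite \<Phi> \<and> definable_partition L C m \<Phi> \<and>
           (\<forall>\<pi>\<in>\<Phi>. \<exists>h\<in>R. \<forall>(M, as)\<in>\<pi>. card (solutions \<phi> M n as) = h M)))"

end

theory Submission
  imports Defs
begin

text \<open>
  Fix \<open>\<phi>(x, y)\<close> with \<open>m\<close> parameter variables. If two \<open>m\<close>-tuples \<open>a\<close>, \<open>b\<close> of some \<open>M\<^sub>i\<close> lie in the same orbit
  of \<open>Aut M\<close>, then by homogeneity an automorphism of \<open>M\<close> preserving \<open>M\<^sub>i\<close> setwise carries \<open>a\<close> to \<open>b\<close>;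
  its restriction is an automorphism of \<open>M\<^sub>i\<close>, so \<open>\<phi>(x, a)\<close> and \<open>\<phi>(x, b)\<close> have equally many solutions
  in \<open>M\<^sub>i\<close> (\<open>card_solutions_orbit\<close>). It remains to see that \<open>M\<close> has finitely many orbits on \<open>m\<close>-tuples
  and that the class \<open>{M\<^sub>i}\<close> defines them uniformly, up to finitely many exceptional \<open>i\<close>.

  The first point is the Ryll-Nardzewski theorem. Suppose \<open>M\<close> realizes infinitely many complete
  \<open>n\<close>-types. One Henkin construction gives a countable \<open>A\<close> elementarily equivalent to \<open>M\<close> with a tuple
  whose type is isolated by no formula; a second one gives a countable elementarily equivalent \<open>G\<close>
  omitting that type. Both being infinite, this contradicts categoricity (\<open>finitely_many_types\<close>). Since
  there are finitely many types in each number of variables, each of them is isolated by a formula, and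
  a back-and-forth argument in the countable structure \<open>M\<close> shows that tuples of the same type are in
  the same orbit (\<open>same_type_same_orbit\<close>).

  For the second point, every formula has the same meaning in \<open>M\<close> and in \<open>M\<^sub>i\<close> once \<open>i\<close> is large
  (\<open>eventually_absolute\<close>): one witness per orbit is enough for a quantifier, finitely many witnesses
  lie in one \<open>M\<^sub>i\<close>, and homogeneity moves them within \<open>M\<^sub>i\<close>. So the formulas isolating the \<open>m\<close>-types of
  \<open>M\<close> control the number of solutions in all \<open>M\<^sub>i\<close> from some index on. In the finitely many remaining
  \<open>M\<^sub>i\<close> the number of solutions is bounded, hence controlled by the formulas saying that there are at
  least \<open>k\<close> solutions, for \<open>k\<close> up to the bound. The tuples are partitioned according to the truth values
  of all these finitely many formulas. Within a cell the number of solutions depends on the structure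
  only, so for \<open>R\<close> one can take the set of all functions.
\<close>

section \<open>Variables, renaming and some particular formulas\<close>

lemma trm_val_cong:
  assumes "is_trm L n t" "\<And>i. i < n \<Longrightarrow> e i = e' i"
  shows "trm_val M e t = trm_val M e' t"
  using assms(1)
proof (induction t)
  case (Var x)
  then show ?case using assms(2) by simp
next
  case (Fn f ts)
  then have "map (trm_val M e) ts = map (trm_val M e') ts" by simp
  then show ?case by (simp only: trm_val.simps)
qed

lemma sat_cong:
  assumes "is_fm L n \<phi>" "\<And>i. i < n \<Longrightarrow> e i = e' i"
  shows "sat M e \<phi> = sat M e' \<phi>"
  using assms
proof (induction \<phi> arbitrary: n e e')
  case (Eq s t)
  have "trm_val M e s = trm_val M e' s" "trm_val M e t = trm_val M e' t"
    using Eq.prems by (auto intro: trm_val_cong[of L n])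
  then show ?case by (simp only: sat.simps)
next
  case (Rel r ts)
  have "map (trm_val M e) ts = map (trm_val M e') ts"
    using Rel.prems by (auto intro: trm_val_cong[of L n])
  then show ?case by (simp only: sat.simps)
next
  case (Neg \<phi>)
  have "is_fm L n \<phi>" using Neg.prems(1) by simp
  from Neg.IH[OF this Neg.prems(2)] show ?case by (simp only: sat.simps)
next
  case (Conj \<phi> \<psi>)
  have "is_fm L n \<phi>" "is_fm L n \<psi>" using Conj.prems(1) by simp_all
  from Conj.IH(1)[OF this(1) Conj.prems(2)] Conj.IH(2)[OF this(2) Conj.prems(2)]
  show ?case by (simp only: sat.simps)
next
  case (Exists \<phi>)
  have "is_fm L (Suc n) \<phi>" using Exists.prems(1) by simp
  moreover have "case_nat x e i = case_nat x e' i" if "i < Suc n" for x i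
    using Exists.prems(2) that by (cases i) auto
  ultimately have "sat M (case_nat x e) \<phi> = sat M (case_nat x e') \<phi>" for x
    by (rule Exists.IH)
  then show ?case by (simp only: sat.simps)
qed

lemma is_trm_mono: "is_trm L n t \<Longrightarrow> n \<le> n' \<Longrightarrow> is_trm L n' t"
  by (induction t) auto

lemma is_fm_mono: "is_fm L n \<phi> \<Longrightarrow> n \<le> n' \<Longrightarrow> is_fm L n' \<phi>"
  by (induction \<phi> arbitrary: n n') (auto intro: is_trm_mono)

primrec rename_trm :: "(nat \<Rightarrow> nat) \<Rightarrow> 'f trm \<Rightarrow> 'f trm" where
  "rename_trm r (Var i) = Var (r i)"
| "rename_trm r (Fn f ts) = Fn f (map (rename_trm r) ts)"

text \<open>Renaming replaces substitution throughout. Index 0 of a quantified formula is bound, so the renaming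
  fixes it and acts on the others shifted by one.\<close>

primrec rename :: "(nat \<Rightarrow> nat) \<Rightarrow> ('f, 'r) fm \<Rightarrow> ('f, 'r) fm" where
  "rename r (Eq s t) = Eq (rename_trm r s) (rename_trm r t)"
| "rename r (Rel R ts) = Rel R (map (rename_trm r) ts)"
| "rename r (Neg \<phi>) = Neg (rename r \<phi>)"
| "rename r (Conj \<phi> \<psi>) = Conj (rename r \<phi>) (rename r \<psi>)"
| "rename r (Exists \<phi>) = Exists (rename (case_nat 0 (Suc \<circ> r)) \<phi>)"

lemma trm_val_rename: "trm_val M e (rename_trm r t) = trm_val M (e \<circ> r) t"
  by (induction t) (auto simp: comp_def cong: map_cong)

lemma sat_rename: "sat M e (rename r \<phi>) = sat M (e \<circ> r) \<phi>"
proof (induction \<phi> arbitrary: e r)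
  case (Exists \<phi>)
  have "case_nat x e \<circ> case_nat 0 (Suc \<circ> r) = case_nat x (e \<circ> r)" for x
    by (auto split: nat.split)
  then show ?case using Exists by (simp only: rename.simps sat.simps)
qed (auto simp: trm_val_rename comp_def cong: map_cong)

lemma is_trm_rename: "is_trm L n t \<Longrightarrow> (\<And>i. i < n \<Longrightarrow> r i < k) \<Longrightarrow> is_trm L k (rename_trm r t)"
  by (induction t) auto

lemma is_fm_rename:
  "is_fm L n \<phi> \<Longrightarrow> (\<And>i. i < n \<Longrightarrow> r i < k) \<Longrightarrow> is_fm L k (rename r \<phi>)"
proof (induction \<phi> arbitrary: n k r)
  case (Exists \<phi>)
  show ?case using Exists.prems
    by (auto intro!: Exists.IH[of "Suc n"] split: nat.split)
qed (auto intro: is_trm_rename)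

text \<open>A true sentence that exists in every language, even one without symbols.\<close>

definition verum :: "('f, 'r) fm" where
  "verum = Neg (Exists (Neg (Eq (Var 0) (Var 0))))"

primrec conjs :: "('f, 'r) fm list \<Rightarrow> ('f, 'r) fm" where
  "conjs [] = verum"
| "conjs (\<phi> # \<phi>s) = Conj \<phi> (conjs \<phi>s)"

lemma is_fm_conjs: "is_fm L n (conjs \<phi>s) \<longleftrightarrow> (\<forall>\<phi>\<in>set \<phi>s. is_fm L n \<phi>)"
  by (induction \<phi>s) (auto simp: verum_def)

lemma sat_conjs: "sat M e (conjs \<phi>s) \<longleftrightarrow> (\<forall>\<phi>\<in>set \<phi>s. sat M e \<phi>)"
  by (induction \<phi>s) (auto simp: verum_def)

definition conj_set :: "('f, 'r) fm set \<Rightarrow> ('f, 'r) fm" where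
  "conj_set F = conjs (SOME \<phi>s. set \<phi>s = F)"

lemma set_SOME_list: "finite F \<Longrightarrow> set (SOME \<phi>s. set \<phi>s = F) = F"
  by (rule someI_ex) (rule finite_list)

lemma is_fm_conj_set: "finite F \<Longrightarrow> is_fm L n (conj_set F) \<longleftrightarrow> (\<forall>\<phi>\<in>F. is_fm L n \<phi>)"
  by (simp add: conj_set_def is_fm_conjs set_SOME_list)

lemma holds_conj_set: "finite F \<Longrightarrow> holds N (conj_set F) as \<longleftrightarrow> (\<forall>\<phi>\<in>F. holds N \<phi> as)"
  by (simp add: conj_set_def sat_conjs holds_def set_SOME_list)

lemma tuples_0 [simp]: "tuples 0 A = {[]}"
  by (auto simp: tuples_def)

lemma finite_tuples: "finite A \<Longrightarrow> finite (tuples n A)"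
  unfolding tuples_def using finite_lists_length_eq[of A n] by (simp add: conj_commute)

lemma case_nat_nth: "case_nat x ((!) xs) = (!) (x # xs)"
  by (rule ext) (simp add: nth_Cons)

lemma holds_simps [simp]:
  "holds M (Neg \<phi>) as \<longleftrightarrow> \<not> holds M \<phi> as"
  "holds M (Conj \<phi> \<psi>) as \<longleftrightarrow> holds M \<phi> as \<and> holds M \<psi> as"
  "holds M (Exists \<phi>) as \<longleftrightarrow> (\<exists>x\<in>univ M. holds M \<phi> (x # as))"
  by (simp_all only: holds_def sat.simps case_nat_nth)

lemma holds_map:
  assumes "is_fm L (length v) \<phi>"
  shows "holds M \<phi> (map e v) \<longleftrightarrow> sat M e (rename ((!) v) \<phi>)"
  using sat_cong[OF assms, of "(!) (map e v)" "e \<circ> (!) v" M] by (simp add: holds_def sat_rename)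

lemma holds_upt:
  assumes "is_fm L n \<phi>"
  shows "holds M \<phi> (map e [0..<n]) \<longleftrightarrow> sat M e \<phi>"
  unfolding holds_def by (rule sat_cong[OF assms]) simp

lemma is_fm_Exists_pow: "is_fm L n ((Exists ^^ k) \<phi>) \<longleftrightarrow> is_fm L (k + n) \<phi>"
  by (induction k arbitrary: n) auto

text \<open>The innermost quantifier binds index 0, so the witnesses appear in front of the given tuple, in the
  same order as in the layout of solutions and parameters.\<close>

lemma holds_Exists_pow:
  "holds M ((Exists ^^ k) \<phi>) as \<longleftrightarrow> (\<exists>ys\<in>tuples k (univ M). holds M \<phi> (ys @ as))"
proof (induction k arbitrary: as)
  case (Suc k)
  have "(\<exists>x\<in>univ M. \<exists>ys\<in>tuples k (univ M). holds M \<phi> (ys @ x # as)) \<longleftrightarrow>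
    (\<exists>zs\<in>tuples (Suc k) (univ M). holds M \<phi> (zs @ as))" (is "?l \<longleftrightarrow> ?r")
  proof
    assume ?l
    then obtain x ys where "x \<in> univ M" "ys \<in> tuples k (univ M)" "holds M \<phi> (ys @ x # as)" by blast
    then show ?r by (intro bexI[of _ "ys @ [x]"]) (auto simp: tuples_def)
  next
    assume ?r
    then obtain zs where zs: "zs \<in> tuples (Suc k) (univ M)" "holds M \<phi> (zs @ as)" by blast
    then obtain ys x where "zs = ys @ [x]"
      by (metis (mono_tags, lifting) length_0_conv mem_Collect_eq nat.distinct(1) rev_exhaust tuples_def)
    with zs show ?l by (intro bexI[of _ x] bexI[of _ ys]) (auto simp: tuples_def)
  qed
  then show ?case using Suc by simp
qed simp

text \<open>Together with \<open>skip_block\<close> this serves to exclude a solution already found: the first block of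
  \<open>n\<close> variables is a new candidate, the second one the old solution.\<close>

definition eq_blocks :: "nat \<Rightarrow> ('f, 'r) fm" where
  "eq_blocks n = conjs (map (\<lambda>l. Eq (Var l) (Var (n + l))) [0..<n])"

lemma holds_eq_blocks:
  assumes "length xs = n" "length zs = n"
  shows "holds N (eq_blocks n) (xs @ zs @ as) \<longleftrightarrow> xs = zs"
proof -
  have "holds N (eq_blocks n) (xs @ zs @ as) \<longleftrightarrow> (\<forall>l<n. (xs @ zs @ as) ! l = (xs @ zs @ as) ! (n + l))"
    by (auto simp: eq_blocks_def holds_def sat_conjs)
  also have "\<dots> \<longleftrightarrow> (\<forall>l<n. xs ! l = zs ! l)"
    using assms by (simp add: nth_append)
  also have "\<dots> \<longleftrightarrow> xs = zs" using assms by (simp add: list_eq_iff_nth_eq)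
  finally show ?thesis .
qed

definition skip_block :: "nat \<Rightarrow> ('f, 'r) fm \<Rightarrow> ('f, 'r) fm" where
  "skip_block n = rename (\<lambda>i. if i < n then i else i + n)"

lemma holds_skip_block:
  assumes "length xs = n" "length zs = n"
  shows "holds N (skip_block n \<phi>) (xs @ zs @ as) \<longleftrightarrow> holds N \<phi> (xs @ as)"
proof -
  have "(!) (xs @ zs @ as) \<circ> (\<lambda>i. if i < n then i else i + n) = (!) (xs @ as)"
    using assms by (simp add: fun_eq_iff nth_append)
  then show ?thesis
    unfolding skip_block_def holds_def sat_rename by simp
qed

text \<open>Recursion on the number of solutions keeps the formula simple: there are \<open>k + 1\<close> solutions of \<open>\<phi>\<close> if
  and only if there is a solution \<open>z\<close> and \<open>k\<close> solutions of \<open>\<phi>(x, y) \<and> x \<noteq> z\<close>, where \<open>z\<close> has become a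
  further parameter.\<close>

primrec at_least :: "nat \<Rightarrow> nat \<Rightarrow> ('f, 'r) fm \<Rightarrow> ('f, 'r) fm" where
  "at_least n 0 \<phi> = verum"
| "at_least n (Suc k) \<phi> =
     (Exists ^^ n) (Conj \<phi> (at_least n k (Conj (skip_block n \<phi>) (Neg (eq_blocks n)))))"

lemma is_fm_at_least: "is_fm L (n + m) \<phi> \<Longrightarrow> is_fm L m (at_least n k \<phi>)"
proof (induction k arbitrary: m \<phi>)
  case (Suc k)
  have "is_fm L (n + (n + m)) (Conj (skip_block n \<phi>) (Neg (eq_blocks n)))"
    using Suc.prems by (auto simp: skip_block_def eq_blocks_def is_fm_conjs intro!: is_fm_rename)
  from Suc.IH[OF this] Suc.prems show ?case by (simp add: is_fm_Exists_pow)
qed (simp add: verum_def)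

lemma holds_at_least:
  "holds N (at_least n k \<phi>) as \<longleftrightarrow> (\<exists>T\<subseteq>solutions \<phi> N n as. finite T \<and> card T = k)"
proof (induction k arbitrary: \<phi> as)
  case 0
  have "\<exists>T\<subseteq>solutions \<phi> N n as. finite T \<and> card T = 0"
    by (rule exI[of _ "{}"]) simp
  then show ?case by (simp add: verum_def holds_def)
next
  case (Suc k)
  let ?\<phi>' = "Conj (skip_block n \<phi>) (Neg (eq_blocks n))"
  have sol: "solutions ?\<phi>' N n (zs @ as) = solutions \<phi> N n as - {zs}"
    if "zs \<in> tuples n (univ N)" for zs
    using that by (auto simp: solutions_def tuples_def holds_skip_block holds_eq_blocks)
  have "holds N (at_least n (Suc k) \<phi>) as \<longleftrightarrow> (\<exists>zs\<in>tuples n (univ N). holds N \<phi> (zs @ as) \<and>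
      (\<exists>T\<subseteq>solutions ?\<phi>' N n (zs @ as). finite T \<and> card T = k))"
    using Suc.IH by (simp add: holds_Exists_pow)
  also have "\<dots> \<longleftrightarrow> (\<exists>zs\<in>solutions \<phi> N n as.
      \<exists>T\<subseteq>solutions \<phi> N n as - {zs}. finite T \<and> card T = k)"
    using sol by (simp add: solutions_def Bex_def conj_assoc)
  also have "\<dots> \<longleftrightarrow> (\<exists>T\<subseteq>solutions \<phi> N n as. finite T \<and> card T = Suc k)" (is "_ \<longleftrightarrow> ?r")
  proof
    assume "\<exists>zs\<in>solutions \<phi> N n as. \<exists>T\<subseteq>solutions \<phi> N n as - {zs}. finite T \<and> card T = k"
    then obtain zs T where "zs \<in> solutions \<phi> N n as" "T \<subseteq> solutions \<phi> N n as - {zs}"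
      "finite T" "card T = k" by blast
    then show ?r by (intro exI[of _ "insert zs T"]) (auto simp: card_insert_if)
  next
    assume ?r
    then obtain T where T: "T \<subseteq> solutions \<phi> N n as" "finite T" "card T = Suc k" by blast
    then obtain zs where "zs \<in> T" by fastforce
    with T show "\<exists>zs\<in>solutions \<phi> N n as. \<exists>T\<subseteq>solutions \<phi> N n as - {zs}. finite T \<and> card T = k"
      by (intro bexI[of _ zs] exI[of _ "T - {zs}"]) auto
  qed
  finally show ?case .
qed

instance trm :: (countable) countable
  by countable_datatype

instance fm :: (countable, countable) countable
  by countable_datatype

lemma is_trm_funs: "is_trm L n t \<Longrightarrow> set_trm t \<subseteq> funs L"
  by (induction t) auto

lemma is_fm_symbols: "is_fm L n \<phi> \<Longrightarrow> set1_fm \<phi> \<subseteq> funs L \<and> set2_fm \<phi> \<subseteq> rels L"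
proof (induction \<phi> arbitrary: n)
  case (Conj \<phi> \<psi>)
  have "is_fm L n \<phi>" "is_fm L n \<psi>" using Conj.prems by simp_all
  from Conj.IH(1)[OF this(1)] Conj.IH(2)[OF this(2)] show ?case by simp
qed (auto dest: is_trm_funs)

definition formulas :: "('f, 'r) lang \<Rightarrow> ('f, 'r) fm set" where
  "formulas L = {\<phi>. \<exists>n. is_fm L n \<phi>}"

text \<open>The types of symbols may be uncountable, so formulas are coded by formulas over \<open>nat\<close>, injectively on
  those that use only symbols of the language.\<close>

lemma countable_formulas:
  assumes "countable (funs L)" "countable (rels L)"
  shows "countable (formulas L)"
proof -
  let ?code = "map_fm (to_nat_on (funs L)) (to_nat_on (rels L))"
  have "inj_on ?code (formulas L)"
  proof (rule inj_onI)
    fix \<phi> \<psi> assume *: "\<phi> \<in> formulas L" "\<psi> \<in> formulas L" "?code \<phi> = ?code \<psi>"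
    then have sub: "set1_fm \<phi> \<subseteq> funs L" "set2_fm \<phi> \<subseteq> rels L" "set1_fm \<psi> \<subseteq> funs L" "set2_fm \<psi> \<subseteq> rels L"
      using is_fm_symbols unfolding formulas_def by blast+
    show "\<phi> = \<psi>"
    proof (rule fm.inj_map_strong[OF _ _ *(3)])
      fix z za assume "z \<in> set1_fm \<phi>" "za \<in> set1_fm \<psi>" "to_nat_on (funs L) z = to_nat_on (funs L) za"
      then show "z = za" using sub assms by (metis in_mono to_nat_on_inj)
    next
      fix z za assume "z \<in> set2_fm \<phi>" "za \<in> set2_fm \<psi>" "to_nat_on (rels L) z = to_nat_on (rels L) za"
      then show "z = za" using sub assms by (metis in_mono to_nat_on_inj)
    qed
  qed
  then show ?thesis by (rule countableI')
qed

lemma formulas_common_bound: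
  assumes "\<phi> \<in> formulas L" "\<psi> \<in> formulas L"
  obtains k where "m \<le> k" "is_fm L k \<phi>" "is_fm L k \<psi>"
proof -
  obtain a b where "is_fm L a \<phi>" "is_fm L b \<psi>" using assms by (auto simp: formulas_def)
  then show thesis by (intro that[of "max m (max a b)"]) (auto intro: is_fm_mono)
qed


section \<open>Structures built from a chain of sets of assignments\<close>

definition assignments :: "('f, 'r, 'a) struct \<Rightarrow> (nat \<Rightarrow> 'a) set" where
  "assignments M = {e. \<forall>i. e i \<in> univ M}"

lemma fint_closed:
  assumes "is_struct L M" "f \<in> funs L" "xs \<in> tuples (farity L f) (univ M)"
  shows "fint M f xs \<in> univ M"
  using assms unfolding is_struct_def by (auto dest!: PiE_mem)

text \<open>A Henkin construction in which a complete theory is replaced by a decreasing chain of sets of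
  assignments of the variables \<open>0, 1, 2, \<dots>\<close> in \<open>M\<close>. A property of assignments is forced if it holds
  throughout some set of the chain. The assumption \<open>D_witness\<close> says that each existential formula is
  eventually refuted, or eventually witnessed by the value of one of the variables. A structure is then
  obtained as for an ultrapower: its elements are the variables, identified when their equality is
  forced, and truth in it is forced truth. The index set of this ultrapower consists of the
  assignments, the chain generates the filter, and of the functions from the index set to \<open>M\<close> only the
  coordinate functions \<open>e \<mapsto> e i\<close> are used.\<close>

locale henkin_chain =
  fixes L :: "('f, 'r) lang" and M :: "('f, 'r, 'a) struct" and D :: "nat \<Rightarrow> (nat \<Rightarrow> 'a) set"
  assumes M: "is_struct L M"
    and D_antimono: "s \<le> t \<Longrightarrow> D t \<subseteq> D s"
    and D_nonempty: "D s \<noteq> {}"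
    and D_assignments: "D s \<subseteq> assignments M"
    and D_witness: "\<phi> \<in> formulas L \<Longrightarrow>
      \<exists>s. (\<forall>e\<in>D s. \<not> sat M e (Exists \<phi>)) \<or> (\<exists>j. \<forall>e\<in>D s. sat M (case_nat (e j) e) \<phi>)"
begin

definition forced :: "((nat \<Rightarrow> 'a) \<Rightarrow> bool) \<Rightarrow> bool" where
  "forced X \<longleftrightarrow> (\<exists>s. \<forall>e\<in>D s. X e)"

lemma forced_True: "forced (\<lambda>e. True)"
  by (simp add: forced_def)

lemma forced_mono: "forced X \<Longrightarrow> (\<And>e. e \<in> assignments M \<Longrightarrow> X e \<Longrightarrow> Y e) \<Longrightarrow> forced Y"
  unfolding forced_def using D_assignments by (meson subset_eq)

lemma forced_conj: "forced (\<lambda>e. X e \<and> Y e) \<longleftrightarrow> forced X \<and> forced Y"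
proof
  assume "forced X \<and> forced Y"
  then obtain s t where "\<forall>e\<in>D s. X e" "\<forall>e\<in>D t. Y e" by (auto simp: forced_def)
  then have "\<forall>e\<in>D (max s t). X e \<and> Y e"
    using D_antimono[of s "max s t"] D_antimono[of t "max s t"] by auto
  then show "forced (\<lambda>e. X e \<and> Y e)" unfolding forced_def by blast
next
  assume XY: "forced (\<lambda>e. X e \<and> Y e)"
  have "forced X" by (rule forced_mono[OF XY]) simp
  moreover have "forced Y" by (rule forced_mono[OF XY]) simp
  ultimately show "forced X \<and> forced Y" by blast
qed

lemma forced_conjI: "forced X \<Longrightarrow> forced Y \<Longrightarrow> forced (\<lambda>e. X e \<and> Y e)"
  by (simp add: forced_conj)

lemma not_forced_False: "\<not> forced (\<lambda>e. False)"
  using D_nonempty by (auto simp: forced_def)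

lemma forced_contradiction: "forced X \<Longrightarrow> forced (\<lambda>e. \<not> X e) \<Longrightarrow> False"
  using not_forced_False forced_conjI[of X "\<lambda>e. \<not> X e"] by simp

lemma forced_cong:
  assumes "forced E" "\<And>e. e \<in> assignments M \<Longrightarrow> E e \<Longrightarrow> X e = Y e"
  shows "forced X \<longleftrightarrow> forced Y"
proof
  assume "forced X"
  from forced_conjI[OF assms(1) this] show "forced Y" by (rule forced_mono) (use assms(2) in blast)
next
  assume "forced Y"
  from forced_conjI[OF assms(1) this] show "forced X" by (rule forced_mono) (use assms(2) in blast)
qed

text \<open>Deciding a formula is a case of witnessing one: add a quantifier over a variable that does not
  occur.\<close>

lemma forced_decides:
  assumes "\<phi> \<in> formulas L"
  shows "forced (\<lambda>e. \<not> sat M e \<phi>) \<longleftrightarrow> \<not> forced (\<lambda>e. sat M e \<phi>)"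
proof -
  have shift: "sat M (case_nat x e) (rename Suc \<phi>) \<longleftrightarrow> sat M e \<phi>" for x e
  proof -
    have "case_nat x e \<circ> Suc = e" by auto
    then show ?thesis by (simp only: sat_rename)
  qed
  obtain n where "is_fm L n \<phi>" using assms by (auto simp: formulas_def)
  then have "is_fm L (Suc n) (rename Suc \<phi>)" by (rule is_fm_rename) auto
  then have "rename Suc \<phi> \<in> formulas L" by (auto simp: formulas_def)
  from D_witness[OF this] have "forced (\<lambda>e. \<not> sat M e \<phi>) \<or> forced (\<lambda>e. sat M e \<phi>)"
    using M unfolding forced_def is_struct_def by (auto simp: shift)
  then show ?thesis using forced_contradiction by blast
qed

lemma forced_witness:
  assumes "\<phi> \<in> formulas L" "forced (\<lambda>e. sat M e (Exists \<phi>))"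
  obtains j where "forced (\<lambda>e. sat M (case_nat (e j) e) \<phi>)"
proof -
  have "\<not> forced (\<lambda>e. \<not> sat M e (Exists \<phi>))"
    using forced_contradiction[OF assms(2)] by blast
  then show thesis using D_witness[OF assms(1)] that unfolding forced_def by blast
qed

text \<open>Taking the least variable in each class avoids a quotient, and the universe consists of natural numbers.\<close>

definition rep :: "nat \<Rightarrow> nat" where
  "rep i = (LEAST j. forced (\<lambda>e. e i = e j))"

lemma forced_rep: "forced (\<lambda>e. e i = e (rep i))"
  unfolding rep_def by (rule LeastI[of _ i]) (simp add: forced_True)

lemma rep_eq_iff: "rep i = rep j \<longleftrightarrow> forced (\<lambda>e. e i = e j)"
proof
  assume "rep i = rep j"
  with forced_conjI[OF forced_rep[of i] forced_rep[of j]] show "forced (\<lambda>e. e i = e j)"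
    by (elim forced_mono) simp
next
  assume ij: "forced (\<lambda>e. e i = e j)"
  have "forced (\<lambda>e. e i = e k) = forced (\<lambda>e. e j = e k)" for k
    by (rule forced_cong[OF ij]) simp
  then show "rep i = rep j" by (simp add: rep_def)
qed

lemma forced_map_rep: "forced (\<lambda>e. map e (map rep js) = map e js)"
proof (induction js)
  case (Cons j js)
  show ?case using forced_conjI[OF forced_rep[of j] Cons] by (rule forced_mono) simp
qed (simp add: forced_True)

definition henkin_model :: "('f, 'r, nat) struct" where
  "henkin_model = \<lparr>univ = range rep,
     fint = (\<lambda>f\<in>funs L. \<lambda>xs\<in>tuples (farity L f) (range rep).
       rep (SOME j. forced (\<lambda>e. fint M f (map e xs) = e j))),
     rint = (\<lambda>r\<in>rels L. {xs \<in> tuples (rarity L r) (range rep). forced (\<lambda>e. map e xs \<in> rint M r)})\<rparr>"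

lemma univ_henkin_model: "univ henkin_model = range rep"
  by (simp add: henkin_model_def)

lemma is_struct_henkin_model: "is_struct L henkin_model"
  by (auto simp: is_struct_def henkin_model_def)

text \<open>Closure under functions comes from the witness property for the formula \<open>\<exists>y. f(x) = y\<close>.\<close>

lemma fint_forced:
  assumes "f \<in> funs L" "length js = farity L f"
  shows "\<exists>j. forced (\<lambda>e. fint M f (map e js) = e j)"
proof -
  let ?\<phi> = "Eq (Fn f (map (\<lambda>i. Var (Suc i)) js)) (Var 0) :: ('f, 'r) fm"
  have "finite (set js)" by simp
  then obtain k where "\<forall>j\<in>set js. j < k" using finite_nat_set_iff_bounded by blast
  then have "is_fm L (Suc k) ?\<phi>" using assms by auto
  then have "?\<phi> \<in> formulas L" by (auto simp: formulas_def simp del: is_fm.simps)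
  moreover have "forced (\<lambda>e. sat M e (Exists ?\<phi>))"
    using forced_True
  proof (rule forced_mono)
    fix e assume "e \<in> assignments M"
    then have "map e js \<in> tuples (farity L f) (univ M)"
      using assms by (auto simp: assignments_def tuples_def)
    from fint_closed[OF M assms(1) this] show "sat M e (Exists ?\<phi>)" by (simp add: comp_def)
  qed
  ultimately obtain j where "forced (\<lambda>e. sat M (case_nat (e j) e) ?\<phi>)" by (rule forced_witness)
  then show ?thesis by (auto simp: comp_def)
qed

lemma henkin_fint:
  assumes "f \<in> funs L" "length js = farity L f"
  obtains j where "fint henkin_model f (map rep js) = rep j" "forced (\<lambda>e. fint M f (map e js) = e j)"
proof
  define j where "j = (SOME j. forced (\<lambda>e. fint M f (map e (map rep js)) = e j))"
  have "map rep js \<in> tuples (farity L f) (range rep)" using assms by (auto simp: tuples_def)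
  then show "fint henkin_model f (map rep js) = rep j"
    using assms(1) by (simp add: henkin_model_def j_def)
  have "length (map rep js) = farity L f" using assms(2) by simp
  from fint_forced[OF assms(1) this]
  have "forced (\<lambda>e. fint M f (map e (map rep js)) = e j)" unfolding j_def by (rule someI_ex)
  from forced_conjI[OF this forced_map_rep[of js]] show "forced (\<lambda>e. fint M f (map e js) = e j)"
    by (rule forced_mono) metis
qed

lemma henkin_trms:
  assumes "\<forall>t\<in>set ts. \<exists>j. trm_val henkin_model (rep \<circ> v) t = rep j \<and>
    forced (\<lambda>e. trm_val M (e \<circ> v) t = e j)"
  shows "\<exists>js. map (trm_val henkin_model (rep \<circ> v)) ts = map rep js \<and>
    forced (\<lambda>e. map (trm_val M (e \<circ> v)) ts = map e js)"
  using assms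
proof (induction ts)
  case Nil
  show ?case by (rule exI[of _ "[]"]) (simp add: forced_True)
next
  case (Cons t ts)
  have "\<forall>t\<in>set ts. \<exists>j. trm_val henkin_model (rep \<circ> v) t = rep j \<and>
    forced (\<lambda>e. trm_val M (e \<circ> v) t = e j)"
    by (intro ballI) (rule bspec[OF Cons.prems], simp)
  from Cons.IH[OF this] obtain js where js: "map (trm_val henkin_model (rep \<circ> v)) ts = map rep js"
    "forced (\<lambda>e. map (trm_val M (e \<circ> v)) ts = map e js)" by (elim exE conjE)
  have "\<exists>j. trm_val henkin_model (rep \<circ> v) t = rep j \<and> forced (\<lambda>e. trm_val M (e \<circ> v) t = e j)"
    by (rule bspec[OF Cons.prems]) simp
  then obtain j where j: "trm_val henkin_model (rep \<circ> v) t = rep j"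
    "forced (\<lambda>e. trm_val M (e \<circ> v) t = e j)" by (elim exE conjE)
  have "forced (\<lambda>e. map (trm_val M (e \<circ> v)) (t # ts) = map e (j # js))"
    using forced_conjI[OF j(2) js(2)] by (rule forced_mono) simp
  moreover have "map (trm_val henkin_model (rep \<circ> v)) (t # ts) = map rep (j # js)"
    using js(1) j(1) by simp
  ultimately show ?case by (intro exI[of _ "j # js"] conjI)
qed

lemma henkin_trm:
  assumes "is_trm L n t"
  shows "\<exists>j. trm_val henkin_model (rep \<circ> v) t = rep j \<and> forced (\<lambda>e. trm_val M (e \<circ> v) t = e j)"
  using assms
proof (induction t)
  case (Var x)
  show ?case by (rule exI[of _ "v x"]) (simp add: forced_True)
next
  case (Fn f ts)
  have "\<forall>t\<in>set ts. \<exists>j. trm_val henkin_model (rep \<circ> v) t = rep j \<and>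
    forced (\<lambda>e. trm_val M (e \<circ> v) t = e j)"
    by (intro ballI Fn.IH) (use Fn.prems in simp_all)
  then obtain js where js: "map (trm_val henkin_model (rep \<circ> v)) ts = map rep js"
    "forced (\<lambda>e. map (trm_val M (e \<circ> v)) ts = map e js)" using henkin_trms by blast
  have f: "f \<in> funs L" using Fn.prems by simp
  have len: "length js = farity L f" using Fn.prems map_eq_imp_length_eq[OF js(1)] by simp
  obtain j where j: "fint henkin_model f (map rep js) = rep j"
    "forced (\<lambda>e. fint M f (map e js) = e j)" by (rule henkin_fint[OF f len])
  have "forced (\<lambda>e. trm_val M (e \<circ> v) (Fn f ts) = e j)"
    using forced_conjI[OF js(2) j(2)] by (rule forced_mono) (simp only: trm_val.simps)
  moreover have "trm_val henkin_model (rep \<circ> v) (Fn f ts) = rep j"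
    by (simp only: trm_val.simps js(1) j(1))
  ultimately show ?case by blast
qed

text \<open>This is the analogue of the theorem of Los. The induction needs the composition with an arbitrary
  \<open>v\<close>, because a quantifier replaces index 0 by an arbitrary variable.\<close>

lemma henkin_sat_comp:
  assumes "is_fm L n \<phi>"
  shows "sat henkin_model (rep \<circ> v) \<phi> \<longleftrightarrow> forced (\<lambda>e. sat M (e \<circ> v) \<phi>)"
  using assms
proof (induction \<phi> arbitrary: n v)
  case (Eq s t)
  have st: "is_trm L n s" "is_trm L n t" using Eq.prems by simp_all
  from henkin_trm[OF st(1), of v] obtain i where i: "trm_val henkin_model (rep \<circ> v) s = rep i" "forced (\<lambda>e. trm_val M (e \<circ> v) s = e i)"
    by (elim exE conjE)
  from henkin_trm[OF st(2), of v] obtain j where j: "trm_val henkin_model (rep \<circ> v) t = rep j" "forced (\<lambda>e. trm_val M (e \<circ> v) t = e j)"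
    by (elim exE conjE)
  have "forced (\<lambda>e. sat M (e \<circ> v) (Eq s t)) = forced (\<lambda>e. e i = e j)"
    by (rule forced_cong[OF forced_conjI[OF i(2) j(2)]]) (simp only: sat.simps)
  then show ?case by (simp only: sat.simps i(1) j(1) rep_eq_iff)
next
  case (Rel r ts)
  have "\<forall>t\<in>set ts. \<exists>j. trm_val henkin_model (rep \<circ> v) t = rep j \<and>
    forced (\<lambda>e. trm_val M (e \<circ> v) t = e j)"
    by (intro ballI henkin_trm[of n]) (use Rel.prems in simp)
  then obtain js where js: "map (trm_val henkin_model (rep \<circ> v)) ts = map rep js"
    "forced (\<lambda>e. map (trm_val M (e \<circ> v)) ts = map e js)" using henkin_trms by blast
  have "length js = rarity L r" using Rel.prems map_eq_imp_length_eq[OF js(1)] by simp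
  then have "map rep js \<in> rint henkin_model r \<longleftrightarrow> forced (\<lambda>e. map e (map rep js) \<in> rint M r)"
    using Rel.prems by (simp add: henkin_model_def tuples_def image_subset_iff del: map_map)
  also have "\<dots> \<longleftrightarrow> forced (\<lambda>e. map (trm_val M (e \<circ> v)) ts \<in> rint M r)"
    by (rule forced_cong[OF forced_conjI[OF forced_map_rep[of js] js(2)]]) metis
  finally show ?case by (simp only: sat.simps js(1))
next
  case (Neg \<phi>)
  obtain k where k: "\<And>i. i < n \<Longrightarrow> v i < k"
    using finite_nat_set_iff_bounded[of "v ` {..<n}"] by auto
  have fm: "is_fm L n \<phi>" using Neg.prems by simp
  have "is_fm L k (rename v \<phi>)" using fm k by (rule is_fm_rename)
  then have "rename v \<phi> \<in> formulas L" unfolding formulas_def by blast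
  from forced_decides[OF this] have "forced (\<lambda>e. \<not> sat M (e \<circ> v) \<phi>) \<longleftrightarrow> \<not> forced (\<lambda>e. sat M (e \<circ> v) \<phi>)"
    by (simp only: sat_rename)
  then show ?case using Neg.IH[OF fm] by (simp only: sat.simps)
next
  case (Conj \<phi> \<psi>)
  have "is_fm L n \<phi>" "is_fm L n \<psi>" using Conj.prems by simp_all
  then show ?case by (simp only: sat.simps forced_conj Conj.IH)
next
  case (Exists \<phi>)
  obtain k where k: "\<And>i. i < n \<Longrightarrow> v i < k"
    using finite_nat_set_iff_bounded[of "v ` {..<n}"] by auto
  let ?\<phi> = "rename (case_nat 0 (Suc \<circ> v)) \<phi>"
  have fm: "is_fm L (Suc n) \<phi>" using Exists.prems by simp
  have "is_fm L (Suc k) ?\<phi>"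
    by (rule is_fm_rename[OF fm]) (use k in \<open>auto split: nat.split\<close>)
  then have fm': "?\<phi> \<in> formulas L" unfolding formulas_def by blast
  have comp: "e \<circ> case_nat j v = case_nat (e j) (e \<circ> v)"
    "case_nat (e j) e \<circ> case_nat 0 (Suc \<circ> v) = case_nat (e j) (e \<circ> v)" for e :: "nat \<Rightarrow> 'b" and j
    by (auto split: nat.split)
  have IH: "sat henkin_model (case_nat (rep j) (rep \<circ> v)) \<phi> \<longleftrightarrow>
      forced (\<lambda>e. sat M (case_nat (e j) (e \<circ> v)) \<phi>)" for j
    using Exists.IH[OF fm, of "case_nat j v"] by (simp only: comp)
  have "sat henkin_model (rep \<circ> v) (Exists \<phi>) \<longleftrightarrow> (\<exists>j. forced (\<lambda>e. sat M (case_nat (e j) (e \<circ> v)) \<phi>))"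
    by (simp only: sat.simps univ_henkin_model bex_simps IH[symmetric] rangeI)
  also have "\<dots> \<longleftrightarrow> forced (\<lambda>e. sat M (e \<circ> v) (Exists \<phi>))"
  proof
    assume "\<exists>j. forced (\<lambda>e. sat M (case_nat (e j) (e \<circ> v)) \<phi>)"
    then obtain j where "forced (\<lambda>e. sat M (case_nat (e j) (e \<circ> v)) \<phi>)" by blast
    then show "forced (\<lambda>e. sat M (e \<circ> v) (Exists \<phi>))"
      by (rule forced_mono) (auto simp: assignments_def)
  next
    assume "forced (\<lambda>e. sat M (e \<circ> v) (Exists \<phi>))"
    then have "forced (\<lambda>e. sat M e (rename v (Exists \<phi>)))" by (simp only: sat_rename)
    then have "forced (\<lambda>e. sat M e (Exists ?\<phi>))" by (simp only: rename.simps)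
    with fm' obtain j where "forced (\<lambda>e. sat M (case_nat (e j) e) ?\<phi>)" by (rule forced_witness)
    then show "\<exists>j. forced (\<lambda>e. sat M (case_nat (e j) (e \<circ> v)) \<phi>)"
      by (auto simp only: sat_rename comp)
  qed
  finally show ?case .
qed

lemma henkin_sat:
  assumes "\<phi> \<in> formulas L"
  shows "sat henkin_model rep \<phi> \<longleftrightarrow> forced (\<lambda>e. sat M e \<phi>)"
  using henkin_sat_comp[of _ \<phi> id] assms by (auto simp: formulas_def)

end


section \<open>Generic models and invariance under isomorphism\<close>

definition ext :: "('f, 'r, 'a) struct \<Rightarrow> ('f, 'r) fm \<Rightarrow> (nat \<Rightarrow> 'a) set" where
  "ext M \<phi> = {e \<in> assignments M. sat M e \<phi>}"

definition trace :: "nat \<Rightarrow> (nat \<Rightarrow> 'a) set \<Rightarrow> 'a list set" where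
  "trace n X = (\<lambda>e. map e [0..<n]) ` X"

lemma verum_formula: "verum \<in> formulas L"
  by (auto simp: formulas_def verum_def intro: exI[of _ 0])

lemma ext_verum: "ext M verum = assignments M"
  by (auto simp: ext_def verum_def)

lemma trace_assignments: 
  assumes "univ M \<noteq> {}"
  shows "trace n (assignments M) = tuples n (univ M)"
proof
  show "trace n (assignments M) \<subseteq> tuples n (univ M)"
    by (auto simp: trace_def assignments_def tuples_def)
  show "tuples n (univ M) \<subseteq> trace n (assignments M)"
  proof
    fix xs assume xs: "xs \<in> tuples n (univ M)"
    obtain a where "a \<in> univ M" using assms by blast
    then have "(\<lambda>i. if i < n then xs ! i else a) \<in> assignments M"
      using xs by (auto simp: assignments_def tuples_def)
    moreover have "xs = map (\<lambda>i. if i < n then xs ! i else a) [0..<n]"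
      using xs by (simp add: tuples_def list_eq_iff_nth_eq)
    ultimately show "xs \<in> trace n (assignments M)" unfolding trace_def by blast
  qed
qed

text \<open>The conditions are formulas whose first \<open>n\<close> variables take a large set of values, where largeness is
  the complement of an ideal. Any such condition can be strengthened to refute or witness an existential
  formula: one of the two cases remains large, and a witness can be put into a variable that occurs in
  neither formula, which leaves the values of the first \<open>n\<close> variables unchanged. Countably many further
  dense requirements \<open>\<Q>\<close> can be met as well. Two notions of largeness are used below: infinitely many
  types (to realize a type that is not isolated), and nonemptiness with \<open>n = 0\<close> (to omit a type).\<close>

lemma generic_model:
  fixes M :: "('f, 'r, 'a) struct" and large :: "'a list set \<Rightarrow> bool"
  assumes M: "is_struct L M" and L: "countable (funs L)" "countable (rels L)"
    and large_tuples: "large (tuples n (univ M))" and not_large_empty: "\<not> large {}"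
    and large_mono: "\<And>X Y. large X \<Longrightarrow> X \<subseteq> Y \<Longrightarrow> large Y"
    and large_Un: "\<And>X Y. large (X \<union> Y) \<Longrightarrow> large X \<or> large Y"
    and \<Q>: "countable \<Q>"
    and dense: "\<And>Q p. Q \<in> \<Q> \<Longrightarrow> p \<in> formulas L \<Longrightarrow> large (trace n (ext M p)) \<Longrightarrow>
      \<exists>q\<in>formulas L. large (trace n (ext M q)) \<and> ext M q \<subseteq> ext M p \<and> Q q"
  shows "\<exists>(A :: ('f, 'r, nat) struct) c. is_struct L A \<and> univ A = range c \<and>
    (\<forall>\<phi>\<in>formulas L. (\<forall>e\<in>assignments M. sat M e \<phi>) \<longrightarrow> sat A c \<phi>) \<and>
    (\<forall>Q\<in>\<Q>. \<exists>q. Q q \<and> (\<forall>\<phi>\<in>formulas L. (\<forall>e\<in>ext M q. sat M e \<phi>) \<longrightarrow> sat A c \<phi>))"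
proof -
  define cond where "cond p \<longleftrightarrow> p \<in> formulas L \<and> large (trace n (ext M p))" for p
  define W where "W \<phi> q \<longleftrightarrow> (\<forall>e\<in>ext M q. \<not> sat M e (Exists \<phi>)) \<or>
    (\<exists>j. \<forall>e\<in>ext M q. sat M (case_nat (e j) e) \<phi>)" for \<phi> q
  have W_dense: "\<exists>q. cond q \<and> ext M q \<subseteq> ext M p \<and> W \<phi> q" if \<phi>: "\<phi> \<in> formulas L" and p: "cond p" for \<phi> p
  proof -
    obtain k where k: "n \<le> k" "is_fm L k \<phi>" "is_fm L k p"
      using formulas_common_bound \<phi> p unfolding cond_def by blast
    let ?no = "Conj p (Neg (Exists \<phi>))"
    \<comment> \<open>the variable \<open>k\<close> is not free in \<open>p\<close> or \<open>\<phi>\<close>; it becomes the witness\<close>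
    let ?yes = "Conj p (rename (case_nat k id) \<phi>)"
    have "is_fm L (Suc k) ?no" "is_fm L (Suc k) ?yes"
      using is_fm_mono[OF k(2)] is_fm_mono[OF k(3)] is_fm_rename[OF k(2), of "case_nat k id" "Suc k"]
      by (auto split: nat.split)
    then have fm: "?no \<in> formulas L" "?yes \<in> formulas L" unfolding formulas_def by blast+
    have sat_yes: "sat M e (rename (case_nat k id) \<phi>) \<longleftrightarrow> sat M (case_nat (e k) e) \<phi>" for e
    proof -
      have "e \<circ> case_nat k id = case_nat (e k) e" by (auto split: nat.split)
      then show ?thesis by (simp only: sat_rename)
    qed
    have "trace n (ext M p) \<subseteq> trace n (ext M ?no) \<union> trace n (ext M ?yes)"
    proof
      fix xs assume "xs \<in> trace n (ext M p)"
      then obtain e where e: "e \<in> assignments M" "sat M e p" "xs = map e [0..<n]"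
        by (auto simp: trace_def ext_def)
      show "xs \<in> trace n (ext M ?no) \<union> trace n (ext M ?yes)"
      proof (cases "sat M e (Exists \<phi>)")
        case False
        with e have "e \<in> ext M ?no" by (auto simp: ext_def)
        with e(3) show ?thesis by (auto simp: trace_def)
      next
        case True
        then obtain x where x: "x \<in> univ M" "sat M (case_nat x e) \<phi>" by auto
        let ?e = "e(k := x)"
        have "?e \<in> assignments M" using e(1) x(1) by (auto simp: assignments_def)
        moreover have "sat M ?e p \<longleftrightarrow> sat M e p" by (rule sat_cong[OF k(3)]) simp
        moreover have "sat M (case_nat x ?e) \<phi> \<longleftrightarrow> sat M (case_nat x e) \<phi>"
          by (rule sat_cong[OF k(2)]) (simp split: nat.split)
        ultimately have "?e \<in> ext M ?yes" using e(2) x(2) sat_yes[of ?e] by (simp add: ext_def)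
        moreover have "xs = map ?e [0..<n]" using e(3) k(1) by simp
        ultimately show ?thesis unfolding trace_def by blast
      qed
    qed
    then have "large (trace n (ext M ?no)) \<or> large (trace n (ext M ?yes))"
      using p large_mono large_Un unfolding cond_def by blast
    moreover have "W \<phi> ?no" unfolding W_def by (auto simp: ext_def)
    moreover have "W \<phi> ?yes" unfolding W_def
      by (rule disjI2, rule exI[of _ k]) (simp add: ext_def sat_yes)
    moreover have "ext M ?no \<subseteq> ext M p" "ext M ?yes \<subseteq> ext M p" by (auto simp: ext_def)
    ultimately show ?thesis using fm unfolding cond_def by blast
  qed
  define \<T> where "\<T> = \<Q> \<union> W ` formulas L"
  have \<T>: "countable \<T>" "\<T> \<noteq> {}"
    using \<Q> countable_formulas[OF L] verum_formula unfolding \<T>_def by blast+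
  have \<T>_dense: "\<exists>q. cond q \<and> ext M q \<subseteq> ext M p \<and> T q" if "T \<in> \<T>" "cond p" for T p
    using that dense W_dense unfolding \<T>_def cond_def by blast
  have start: "cond verum"
    using large_tuples M trace_assignments[of M n] verum_formula
    unfolding cond_def is_struct_def ext_verum by simp
  obtain p where p: "\<And>s. cond (p s)"
    and step: "\<And>s. ext M (p (Suc s)) \<subseteq> ext M (p s) \<and> from_nat_into \<T> s (p (Suc s))"
    using dependent_nat_choice[of "\<lambda>_. cond" "\<lambda>s p q. ext M q \<subseteq> ext M p \<and> from_nat_into \<T> s q"]
      start \<T>_dense from_nat_into[OF \<T>(2)] by metis
  have met: "\<exists>s. T (p s)" if "T \<in> \<T>" for T
    using step from_nat_into_surj[OF \<T>(1) that] by metis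
  interpret henkin_chain L M "\<lambda>s. ext M (p s)"
  proof
    show "is_struct L M" by (rule M)
    show "ext M (p t) \<subseteq> ext M (p s)" if "s \<le> t" for s t
      by (rule lift_Suc_antimono_le[of "\<lambda>s. ext M (p s)", OF _ that]) (rule conjunct1[OF step])
    show "ext M (p s) \<noteq> {}" for s
    proof
      assume "ext M (p s) = {}"
      with p[of s] not_large_empty show False by (simp add: cond_def trace_def)
    qed
    show "ext M (p s) \<subseteq> assignments M" for s by (auto simp: ext_def)
    show "\<exists>s. (\<forall>e\<in>ext M (p s). \<not> sat M e (Exists \<phi>)) \<or>
        (\<exists>j. \<forall>e\<in>ext M (p s). sat M (case_nat (e j) e) \<phi>)" if "\<phi> \<in> formulas L" for \<phi>
      using met[of "W \<phi>"] that unfolding \<T>_def W_def by blast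
  qed
  have sat: "sat henkin_model rep \<phi>" if "\<phi> \<in> formulas L" "\<forall>e\<in>ext M (p s). sat M e \<phi>" for \<phi> s
    using that henkin_sat[OF that(1)] unfolding forced_def by blast
  have "\<exists>q. Q q \<and> (\<forall>\<phi>\<in>formulas L. (\<forall>e\<in>ext M q. sat M e \<phi>) \<longrightarrow> sat henkin_model rep \<phi>)" if Q: "Q \<in> \<Q>" for Q
  proof -
    obtain s where "Q (p s)" using met[of Q] Q unfolding \<T>_def by blast
    then show ?thesis using sat[of _ s] by (intro exI[of _ "p s"]) simp
  qed
  moreover have "sat henkin_model rep \<phi>" if "\<phi> \<in> formulas L" "\<forall>e\<in>assignments M. sat M e \<phi>" for \<phi>
    using that by (intro sat[of _ 0]) (auto simp: ext_def)
  ultimately show ?thesis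
    using is_struct_henkin_model univ_henkin_model by (intro exI[of _ henkin_model] exI[of _ rep]) simp
qed

lemma isomorphism_trm_val:
  assumes g: "isomorphism L M N g" and M: "is_struct L M"
    and "is_trm L n t" and e: "\<And>i. i < n \<Longrightarrow> e i \<in> univ M"
  shows "trm_val M e t \<in> univ M \<and> trm_val N (g \<circ> e) t = g (trm_val M e t)"
  using assms(3)
proof (induction t)
  case (Var x)
  then show ?case using e by simp
next
  case (Fn f ts)
  have IH: "\<forall>t\<in>set ts. trm_val M e t \<in> univ M \<and> trm_val N (g \<circ> e) t = g (trm_val M e t)"
    by (intro ballI Fn.IH) (use Fn.prems in simp_all)
  then have "map (trm_val M e) ts \<in> tuples (farity L f) (univ M)"
    using Fn.prems by (auto simp: tuples_def)
  moreover have "fint M f \<in> tuples (farity L f) (univ M) \<rightarrow>\<^sub>E univ M"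
    using M Fn.prems by (auto simp: is_struct_def)
  moreover have "map (trm_val N (g \<circ> e)) ts = map g (map (trm_val M e) ts)"
    using IH by simp
  ultimately show ?case
    using g Fn.prems unfolding isomorphism_def
    by (metis PiE_mem is_trm.simps(2) trm_val.simps(2))
qed

lemma isomorphism_sat:
  assumes g: "isomorphism L M N g" and M: "is_struct L M"
    and "is_fm L n \<phi>" and "\<And>i. i < n \<Longrightarrow> e i \<in> univ M"
  shows "sat N (g \<circ> e) \<phi> \<longleftrightarrow> sat M e \<phi>"
  using assms(3,4)
proof (induction \<phi> arbitrary: n e)
  case (Eq s t)
  have "is_trm L n s" "is_trm L n t" using Eq.prems by simp_all
  note st = isomorphism_trm_val[OF g M this(1) Eq.prems(2)] isomorphism_trm_val[OF g M this(2) Eq.prems(2)]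
  have "inj_on g (univ M)" using g by (simp add: isomorphism_def bij_betw_def)
  then show ?case using st by (simp only: sat.simps inj_on_eq_iff)
next
  case (Rel r ts)
  have ts: "trm_val M e t \<in> univ M \<and> trm_val N (g \<circ> e) t = g (trm_val M e t)" if "t \<in> set ts" for t
    using that Rel.prems(1) by (intro isomorphism_trm_val[OF g M _ Rel.prems(2)]) simp_all
  then have "map (trm_val M e) ts \<in> tuples (rarity L r) (univ M)"
    using Rel.prems(1) by (auto simp: tuples_def)
  moreover have "map (trm_val N (g \<circ> e)) ts = map g (map (trm_val M e) ts)"
    using ts by simp
  ultimately show ?case using g Rel.prems(1) by (simp only: isomorphism_def sat.simps is_fm.simps)
next
  case (Neg \<phi>)
  have "is_fm L n \<phi>" using Neg.prems(1) by simp
  from Neg.IH[OF this Neg.prems(2)] show ?case by (simp only: sat.simps)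
next
  case (Conj \<phi> \<psi>)
  have "is_fm L n \<phi>" "is_fm L n \<psi>" using Conj.prems(1) by simp_all
  from Conj.IH(1)[OF this(1) Conj.prems(2)] Conj.IH(2)[OF this(2) Conj.prems(2)]
  show ?case by (simp only: sat.simps)
next
  case (Exists \<phi>)
  have fm: "is_fm L (Suc n) \<phi>" using Exists.prems(1) by simp
  have "sat N (case_nat (g x) (g \<circ> e)) \<phi> \<longleftrightarrow> sat M (case_nat x e) \<phi>" if "x \<in> univ M" for x
  proof -
    have "g \<circ> case_nat x e = case_nat (g x) (g \<circ> e)" by (auto split: nat.split)
    moreover have "case_nat x e i \<in> univ M" if "i < Suc n" for i
      using that \<open>x \<in> univ M\<close> Exists.prems(2) by (cases i) auto
    ultimately show ?thesis using Exists.IH[OF fm, of "case_nat x e"] by simp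
  qed
  moreover have "univ N = g ` univ M" using g by (simp add: isomorphism_def bij_betw_def)
  ultimately show ?case by (simp only: sat.simps bex_simps(7) cong: bex_cong)
qed

lemma isomorphism_holds:
  assumes "isomorphism L M N g" "is_struct L M" "is_fm L (length as) \<phi>" "set as \<subseteq> univ M"
  shows "holds N \<phi> (map g as) \<longleftrightarrow> holds M \<phi> as"
proof -
  have "holds N \<phi> (map g as) \<longleftrightarrow> sat N (g \<circ> (!) as) \<phi>"
    unfolding holds_def by (rule sat_cong[OF assms(3)]) simp
  also have "\<dots> \<longleftrightarrow> holds M \<phi> as"
    unfolding holds_def by (rule isomorphism_sat[OF assms(1,2,3)]) (use assms(4) in auto)
  finally show ?thesis .
qed


section \<open>Countable categoricity implies finitely many types\<close>

definition type_of :: "('f, 'r) lang \<Rightarrow> ('f, 'r, 'a) struct \<Rightarrow> 'a list \<Rightarrow> ('f, 'r) fm set" where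
  "type_of L M as = {\<phi>. is_fm L (length as) \<phi> \<and> holds M \<phi> as}"

lemma type_of_eq_iff:
  assumes "as \<in> tuples n A" "bs \<in> tuples n B"
  shows "type_of L M as = type_of L N bs \<longleftrightarrow> (\<forall>\<phi>. is_fm L n \<phi> \<longrightarrow> holds M \<phi> as = holds N \<phi> bs)"
  using assms by (auto simp: type_of_def tuples_def)

lemma model_Th_iff:
  assumes "is_model L (Th L M) A" "is_fm L 0 \<phi>"
  shows "holds A \<phi> [] \<longleftrightarrow> holds M \<phi> []"
proof -
  have "holds M \<psi> [] \<Longrightarrow> holds A \<psi> []" if "is_fm L 0 \<psi>" for \<psi>
    using assms(1) that by (simp add: is_model_def Th_def)
  from this[of \<phi>] this[of "Neg \<phi>"] show ?thesis using assms(2) by auto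
qed

text \<open>Finiteness is a property of the theory because ``at least \<open>k\<close> elements'' is a sentence for each \<open>k\<close>.\<close>

lemma model_Th_finite_iff:
  fixes M :: "('f, 'r, 'a) struct" and A :: "('f, 'r, 'b) struct"
  assumes "is_model L (Th L M) A"
  shows "finite (univ A) \<longleftrightarrow> finite (univ M)"
proof -
  define big :: "nat \<Rightarrow> ('f, 'r) fm" where "big k = at_least 1 k verum" for k
  have big_fm: "is_fm L 0 (big k)" for k
    unfolding big_def by (rule is_fm_at_least) (simp add: verum_def)
  have big: "infinite (univ N) \<longleftrightarrow> (\<forall>k. holds N (big k) [])" for N :: "('f, 'r, 'c) struct"
  proof -
    have sol: "solutions verum N 1 [] = (\<lambda>x. [x]) ` univ N"
      by (auto simp: solutions_def tuples_def verum_def length_Suc_conv holds_def)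
    have fin: "finite (univ N) \<longleftrightarrow> finite (solutions verum N 1 [])"
      unfolding sol by (simp add: finite_image_iff inj_on_def)
    show ?thesis
    proof
      assume "infinite (univ N)"
      then have "infinite (solutions verum N 1 [])" using fin by simp
      then show "\<forall>k. holds N (big k) []"
        unfolding big_def holds_at_least using infinite_arbitrarily_large by blast
    next
      assume *: "\<forall>k. holds N (big k) []"
      show "infinite (univ N)"
      proof
        assume "finite (univ N)"
        then have fin': "finite (solutions verum N 1 [])" using fin by simp
        from *[rule_format, of "Suc (card (solutions verum N 1 []))"] obtain T where
          T: "T \<subseteq> solutions verum N 1 []" "card T = Suc (card (solutions verum N 1 []))"
          unfolding big_def holds_at_least by blast
        from card_mono[OF fin' T(1)] T(2) show False by simp
      qed
    qed
  qed
  show ?thesis using big[of A] big[of M] model_Th_iff[OF assms big_fm] by blast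
qed

lemma is_model_Th_of_assignment:
  assumes "is_struct L M" "is_struct L A"
    "\<forall>\<phi>\<in>formulas L. (\<forall>e\<in>assignments M. sat M e \<phi>) \<longrightarrow> sat A c \<phi>"
  shows "is_model L (Th L M) A"
  unfolding is_model_def
proof (intro conjI ballI)
  fix \<phi> assume "\<phi> \<in> Th L M"
  then have \<phi>: "is_fm L 0 \<phi>" "sat M ((!) []) \<phi>" by (auto simp: Th_def holds_def)
  have "sat M e \<phi>" for e
    using \<phi>(2) sat_cong[OF \<phi>(1), of e "(!) []" M] by simp
  moreover have "\<phi> \<in> formulas L" using \<phi>(1) unfolding formulas_def by blast
  ultimately have "sat A c \<phi>" using assms(3) by simp
  then show "holds A \<phi> []" unfolding holds_def using sat_cong[OF \<phi>(1), of c "(!) []" A] by simp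
qed (rule assms(2))

text \<open>The values that assignments satisfying \<open>p\<close> give to a list \<open>v\<close> of variables form a definable set.
  Omitting a type at \<open>v\<close> needs this: if every assignment satisfying a condition gave \<open>v\<close> values of
  that type, then this formula would isolate the type.\<close>

lemma projection_formula:
  fixes M :: "('f, 'r, 'a) struct"
  assumes "is_fm L k p" and v: "\<forall>j\<in>set v. j < k"
  obtains \<theta> where "is_fm L (length v) \<theta>"
    "\<And>as. length as = length v \<Longrightarrow> holds M \<theta> as \<longleftrightarrow> (\<exists>ys\<in>tuples k (univ M). holds M p ys \<and> map ((!) ys) v = as)"
proof -
  define eqs :: "('f, 'r) fm" where "eqs = conjs (map (\<lambda>i. Eq (Var (v ! i)) (Var (k + i))) [0..<length v])"
  let ?\<theta> = "(Exists ^^ k) (Conj p eqs)"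
  have "is_fm L (k + length v) eqs"
    using v by (auto simp: eqs_def is_fm_conjs intro: trans_less_add1)
  then have fm: "is_fm L (length v) ?\<theta>"
    using is_fm_mono[OF assms(1)] by (simp add: is_fm_Exists_pow)
  have "holds M ?\<theta> as \<longleftrightarrow> (\<exists>ys\<in>tuples k (univ M). holds M p ys \<and> map ((!) ys) v = as)"
    if len: "length as = length v" for as
    unfolding holds_Exists_pow
  proof (rule bex_cong[OF refl])
    fix ys assume "ys \<in> tuples k (univ M)"
    then have k: "length ys = k" by (simp add: tuples_def)
    have "holds M p (ys @ as) \<longleftrightarrow> holds M p ys"
      unfolding holds_def by (rule sat_cong[OF assms(1)]) (simp add: nth_append k)
    moreover have "holds M eqs (ys @ as) \<longleftrightarrow> (\<forall>i<length v. (ys @ as) ! (v ! i) = as ! i)"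
      using k by (auto simp: eqs_def holds_def sat_conjs nth_append)
    moreover have "\<dots> \<longleftrightarrow> map ((!) ys) v = as"
      using k v len by (simp add: list_eq_iff_nth_eq nth_append)
    ultimately show "holds M (Conj p eqs) (ys @ as) \<longleftrightarrow> holds M p ys \<and> map ((!) ys) v = as"
      by simp
  qed
  with fm show thesis by (rule that)
qed

text \<open>Assume infinitely many types. Removing from a set of tuples with infinitely many types those that
  satisfy an isolating formula removes one type at most, so the first generic model \<open>A\<close> can avoid all
  isolating formulas at its first \<open>n\<close> variables. Let \<open>t\<close> be the tuple of these in \<open>A\<close>. A formula that is
  satisfiable in \<open>M\<close> cannot entail the whole type of \<open>t\<close>: it would isolate this type and then, by the
  choice of \<open>A\<close>, its negation would belong to the type. So a second generic model \<open>G\<close> can omit the type of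
  \<open>t\<close> at every list of \<open>n\<close> variables, and \<open>A\<close> and \<open>G\<close> are not isomorphic.\<close>

lemma finitely_many_types:
  fixes M :: "('f, 'r, 'a) struct"
  assumes cat: "aleph0_categorical L M" and L: "countable (funs L)" "countable (rels L)"
  shows "finite (type_of L M ` tuples n (univ M))"
proof (rule ccontr)
  assume inf: "infinite (type_of L M ` tuples n (univ M))"
  have M: "is_struct L M" using cat by (simp add: aleph0_categorical_def)
  obtain A0 :: "('f, 'r, nat) struct" where "is_model L (Th L M) A0" "infinite (univ A0)"
    using cat by (auto simp: aleph0_categorical_def)
  then have infM: "infinite (univ M)" using model_Th_finite_iff by blast
  define isolates where "isolates \<theta> \<longleftrightarrow> is_fm L n \<theta> \<and> (\<forall>as\<in>tuples n (univ M). \<forall>bs\<in>tuples n (univ M).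
    holds M \<theta> as \<longrightarrow> holds M \<theta> bs \<longrightarrow> type_of L M as = type_of L M bs)" for \<theta>
  \<comment> \<open>the requirement that puts the negation of an isolating formula into the type of the first \<open>n\<close> variables\<close>
  define avoid where "avoid \<theta> q \<longleftrightarrow> (\<forall>e\<in>ext M q. \<not> sat M e \<theta>)" for \<theta> q
  have "\<exists>(A :: ('f, 'r, nat) struct) c. is_struct L A \<and> univ A = range c \<and>
    (\<forall>\<phi>\<in>formulas L. (\<forall>e\<in>assignments M. sat M e \<phi>) \<longrightarrow> sat A c \<phi>) \<and>
    (\<forall>Q\<in>avoid ` {\<theta>. isolates \<theta>}. \<exists>q. Q q \<and> (\<forall>\<phi>\<in>formulas L. (\<forall>e\<in>ext M q. sat M e \<phi>) \<longrightarrow> sat A c \<phi>))"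
  proof (rule generic_model[where n = n and large = "\<lambda>X. infinite (type_of L M ` X)"])
    have "{\<theta>. isolates \<theta>} \<subseteq> formulas L" unfolding isolates_def formulas_def by blast
    then show "countable (avoid ` {\<theta>. isolates \<theta>})"
      using countable_formulas[OF L] countable_subset by blast
    fix Q p
    assume "Q \<in> avoid ` {\<theta>. isolates \<theta>}" "p \<in> formulas L" and
      large: "infinite (type_of L M ` trace n (ext M p))"
    then obtain \<theta> where \<theta>: "isolates \<theta>" "Q = avoid \<theta>" by blast
    then have "\<theta> \<in> formulas L" unfolding formulas_def isolates_def by blast
    from formulas_common_bound[OF \<open>p \<in> formulas L\<close> this] obtain k where
      k: "is_fm L k p" "is_fm L k \<theta>" .
    let ?q = "Conj p (Neg \<theta>)"
    define X where "X = {as \<in> tuples n (univ M). holds M \<theta> as}"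
    have "is_fm L k ?q" using k by simp
    then have "?q \<in> formulas L" unfolding formulas_def by blast
    moreover have "trace n (ext M p) \<subseteq> trace n (ext M ?q) \<union> X"
    proof
      fix as assume "as \<in> trace n (ext M p)"
      then obtain e where e: "e \<in> assignments M" "sat M e p" "as = map e [0..<n]"
        by (auto simp: trace_def ext_def)
      have "holds M \<theta> as \<longleftrightarrow> sat M e \<theta>"
        using \<theta>(1) holds_upt[of L n \<theta>] unfolding e(3) isolates_def by blast
      moreover have "as \<in> tuples n (univ M)" using e by (auto simp: tuples_def assignments_def)
      ultimately show "as \<in> trace n (ext M ?q) \<union> X"
        using e by (cases "sat M e \<theta>") (auto simp: X_def trace_def ext_def)
    qed
    then have sub: "type_of L M ` trace n (ext M p) \<subseteq> type_of L M ` trace n (ext M ?q) \<union> type_of L M ` X"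
      by blast
    have "finite (type_of L M ` X)"
    proof (cases "X = {}")
      case False
      then obtain a where "a \<in> X" by blast
      then have "type_of L M ` X \<subseteq> {type_of L M a}"
        using \<theta>(1) unfolding isolates_def X_def by blast
      then show ?thesis using finite_subset by blast
    qed simp
    then have "infinite (type_of L M ` trace n (ext M ?q))"
      using large sub finite_subset finite_UnI by metis
    moreover have "ext M ?q \<subseteq> ext M p" "Q ?q" by (auto simp: ext_def \<theta>(2) avoid_def)
    ultimately show "\<exists>q\<in>formulas L. infinite (type_of L M ` trace n (ext M q)) \<and>
        ext M q \<subseteq> ext M p \<and> Q q" by blast
  next
    fix X Y :: "'a list set"
    show "infinite (type_of L M ` X) \<Longrightarrow> X \<subseteq> Y \<Longrightarrow> infinite (type_of L M ` Y)"
      using finite_subset image_mono by metis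
    show "infinite (type_of L M ` (X \<union> Y)) \<Longrightarrow> infinite (type_of L M ` X) \<or> infinite (type_of L M ` Y)"
      by (simp add: image_Un)
  qed (use M L inf in simp_all)
  then obtain A :: "('f, 'r, nat) struct" and c where A: "is_struct L A" "univ A = range c"
    "\<forall>\<phi>\<in>formulas L. (\<forall>e\<in>assignments M. sat M e \<phi>) \<longrightarrow> sat A c \<phi>" and
    A_avoid: "\<forall>Q\<in>avoid ` {\<theta>. isolates \<theta>}. \<exists>q. Q q \<and> (\<forall>\<phi>\<in>formulas L. (\<forall>e\<in>ext M q. sat M e \<phi>) \<longrightarrow> sat A c \<phi>)"
    by (elim exE conjE)
  define t where "t = map c [0..<n]"
  have t_tuple: "t \<in> tuples n (univ A)" by (auto simp: t_def tuples_def A(2))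
  have modA: "is_model L (Th L M) A" by (rule is_model_Th_of_assignment[OF M A(1,3)])
  have not_isolated: "\<not> holds A \<theta> t" if \<theta>: "isolates \<theta>" for \<theta>
  proof -
    have fm: "is_fm L n \<theta>" using \<theta> by (simp add: isolates_def)
    then have "is_fm L n (Neg \<theta>)" by simp
    then have "Neg \<theta> \<in> formulas L" unfolding formulas_def by blast
    moreover obtain q where q: "avoid \<theta> q" and
      "\<forall>\<phi>\<in>formulas L. (\<forall>e\<in>ext M q. sat M e \<phi>) \<longrightarrow> sat A c \<phi>"
      using A_avoid \<theta> by blast
    ultimately have "(\<forall>e\<in>ext M q. sat M e (Neg \<theta>)) \<longrightarrow> sat A c (Neg \<theta>)" by blast
    then have "sat A c (Neg \<theta>)" using q unfolding avoid_def by simp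
    then show ?thesis using holds_upt[OF fm, of A c] by (simp add: t_def)
  qed
  have split: "\<exists>\<psi>\<in>type_of L A t. \<exists>as\<in>tuples n (univ M). holds M \<theta> as \<and> \<not> holds M \<psi> as"
    if \<theta>: "is_fm L n \<theta>" and a: "a \<in> tuples n (univ M)" "holds M \<theta> a" for \<theta> a
  proof (rule ccontr)
    assume neg: "\<not> (\<exists>\<psi>\<in>type_of L A t. \<exists>as\<in>tuples n (univ M). holds M \<theta> as \<and> \<not> holds M \<psi> as)"
    have type: "holds M \<psi> as \<longleftrightarrow> holds A \<psi> t"
      if "as \<in> tuples n (univ M)" "holds M \<theta> as" "is_fm L n \<psi>" for as \<psi>
    proof -
      have "\<psi>' \<in> type_of L A t \<longleftrightarrow> holds A \<psi>' t" if "is_fm L n \<psi>'" for \<psi>'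
        using that t_tuple by (simp add: type_of_def tuples_def)
      from this[of \<psi>] this[of "Neg \<psi>"] neg that show ?thesis by auto
    qed
    then have "isolates \<theta>" using \<theta> by (auto simp: isolates_def type_of_eq_iff)
    from not_isolated[OF this] type[OF a \<theta>] a(2) show False by simp
  qed
  \<comment> \<open>the requirement that the variables \<open>v\<close> do not realize the type of \<open>t\<close>\<close>
  define omit where "omit v q \<longleftrightarrow> (\<exists>\<psi>\<in>type_of L A t. \<forall>e\<in>ext M q. \<not> sat M e (rename ((!) v) \<psi>))"
    for v :: "nat list" and q
  have "\<exists>(G :: ('f, 'r, nat) struct) c. is_struct L G \<and> univ G = range c \<and>
    (\<forall>\<phi>\<in>formulas L. (\<forall>e\<in>assignments M. sat M e \<phi>) \<longrightarrow> sat G c \<phi>) \<and>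
    (\<forall>Q\<in>omit ` {v. length v = n}. \<exists>q. Q q \<and> (\<forall>\<phi>\<in>formulas L. (\<forall>e\<in>ext M q. sat M e \<phi>) \<longrightarrow> sat G c \<phi>))"
  proof (rule generic_model[where n = 0 and large = "\<lambda>X. X \<noteq> {}"])
    show "countable (omit ` {v. length v = n})" by simp
    fix Q p
    assume "Q \<in> omit ` {v. length v = n}" "p \<in> formulas L" "trace 0 (ext M p) \<noteq> {}"
    then obtain v e where v: "length v = n" "Q = omit v" and e: "e \<in> ext M p"
      by (auto simp: trace_def)
    obtain k0 where k0: "is_fm L k0 p" using \<open>p \<in> formulas L\<close> by (auto simp: formulas_def)
    obtain k1 where k1: "\<forall>j\<in>set v. j < k1" using finite_nat_set_iff_bounded[of "set v"] by auto
    define k where "k = max k0 k1"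
    have k: "is_fm L k p" "\<forall>j\<in>set v. j < k"
      using is_fm_mono[OF k0, of k] k1 by (auto simp: k_def)
    obtain \<theta> where \<theta>: "is_fm L n \<theta>" "\<And>as. length as = n \<Longrightarrow>
        holds M \<theta> as \<longleftrightarrow> (\<exists>ys\<in>tuples k (univ M). holds M p ys \<and> map ((!) ys) v = as)"
      using projection_formula[OF k(1,2), of M] v(1) by metis
    have eM: "e \<in> assignments M" "sat M e p" using e by (auto simp: ext_def)
    have "map e [0..<k] \<in> tuples k (univ M)" using eM(1) by (auto simp: tuples_def assignments_def)
    moreover have "holds M p (map e [0..<k])" using holds_upt[OF k(1)] eM(2) by blast
    moreover have "map ((!) (map e [0..<k])) v = map e v" using k(2) by simp
    ultimately have "holds M \<theta> (map e v)" using \<theta>(2)[of "map e v"] v(1) by auto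
    moreover have "map e v \<in> tuples n (univ M)" using eM(1) v(1) by (auto simp: tuples_def assignments_def)
    ultimately obtain \<psi> as where \<psi>: "\<psi> \<in> type_of L A t" and as: "as \<in> tuples n (univ M)"
      "holds M \<theta> as" "\<not> holds M \<psi> as" using split[OF \<theta>(1)] by blast
    have \<psi>_fm: "is_fm L n \<psi>" using \<psi> t_tuple by (simp add: type_of_def tuples_def)
    obtain ys where ys: "ys \<in> tuples k (univ M)" "holds M p ys" "map ((!) ys) v = as"
      using \<theta>(2)[of as] as(1,2) by (auto simp: tuples_def)
    \<comment> \<open>only the variables below \<open>k\<close> matter for \<open>p\<close> and \<open>v\<close>; the others keep arbitrary values in \<open>M\<close>\<close>
    define d where "d i = (if i < k then ys ! i else e i)" for i
    let ?q = "Conj p (Neg (rename ((!) v) \<psi>))"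
    have "map d v = as" using ys(3) k(2) by (auto simp: d_def)
    then have "\<not> sat M d (rename ((!) v) \<psi>)"
      using as(3) holds_map[of L v \<psi> M d] \<psi>_fm v(1) by simp
    moreover have "d \<in> assignments M" using ys(1) eM(1) by (auto simp: d_def assignments_def tuples_def)
    moreover have "sat M d p"
      using ys(2) sat_cong[OF k(1), of d "(!) ys" M] by (simp add: d_def holds_def)
    ultimately have d: "d \<in> ext M ?q" by (simp add: ext_def)
    have "is_fm L k (rename ((!) v) \<psi>)"
      by (rule is_fm_rename[OF \<psi>_fm]) (use k(2) v(1) in simp)
    then have "is_fm L k ?q" using k(1) by simp
    then have "?q \<in> formulas L" unfolding formulas_def by blast
    moreover have "trace 0 (ext M ?q) \<noteq> {}" using d by (auto simp: trace_def)
    moreover have "ext M ?q \<subseteq> ext M p" by (auto simp: ext_def)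
    moreover have "Q ?q" unfolding v(2) omit_def by (rule bexI[OF _ \<psi>]) (auto simp: ext_def)
    ultimately show "\<exists>q\<in>formulas L. trace 0 (ext M q) \<noteq> {} \<and> ext M q \<subseteq> ext M p \<and> Q q" by blast
  qed (use M L in auto)
  then obtain G :: "('f, 'r, nat) struct" and d where G: "is_struct L G" "univ G = range d"
    "\<forall>\<phi>\<in>formulas L. (\<forall>e\<in>assignments M. sat M e \<phi>) \<longrightarrow> sat G d \<phi>" and
    G_omit: "\<forall>Q\<in>omit ` {v. length v = n}. \<exists>q. Q q \<and> (\<forall>\<phi>\<in>formulas L. (\<forall>e\<in>ext M q. sat M e \<phi>) \<longrightarrow> sat G d \<phi>)"
    by (elim exE conjE)
  have modG: "is_model L (Th L M) G" by (rule is_model_Th_of_assignment[OF M G(1,3)])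
  have "isomorphic L A G"
    using cat modA modG infM model_Th_finite_iff[OF modA] model_Th_finite_iff[OF modG]
    unfolding aleph0_categorical_def by blast
  then obtain g where g: "isomorphism L A G g" by (auto simp: isomorphic_def)
  \<comment> \<open>the image of \<open>t\<close> is listed by some variables \<open>?v\<close>, at which the type has been omitted\<close>
  have "set (map g t) \<subseteq> range d"
    using g t_tuple unfolding isomorphism_def G(2)[symmetric] by (auto simp: tuples_def bij_betw_def)
  then have "\<forall>x\<in>set (map g t). \<exists>j. x = d j" by blast
  from bchoice[OF this] obtain r where "\<forall>x\<in>set (map g t). x = d (r x)" by (elim exE)
  then have v: "map d (map r (map g t)) = map g t" by simp
  let ?v = "map r (map g t)"
  have len: "length ?v = n" using t_tuple by (simp add: tuples_def)
  then obtain q where q: "omit ?v q" "\<forall>\<phi>\<in>formulas L. (\<forall>e\<in>ext M q. sat M e \<phi>) \<longrightarrow> sat G d \<phi>"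
    using G_omit by blast
  then obtain \<psi> where \<psi>: "\<psi> \<in> type_of L A t" "\<forall>e\<in>ext M q. \<not> sat M e (rename ((!) ?v) \<psi>)"
    unfolding omit_def by blast
  have \<psi>_fm: "is_fm L (length ?v) \<psi>" "is_fm L (length t) \<psi>" "holds A \<psi> t"
    using \<psi>(1) t_tuple by (simp_all add: type_of_def tuples_def)
  obtain k where k: "\<forall>j\<in>set ?v. j < k" using finite_nat_set_iff_bounded[of "set ?v"] by auto
  have "is_fm L k (rename ((!) ?v) \<psi>)"
    by (rule is_fm_rename[OF \<psi>_fm(1)]) (use k nth_mem in blast)
  then have "is_fm L k (Neg (rename ((!) ?v) \<psi>))" by simp
  then have "Neg (rename ((!) ?v) \<psi>) \<in> formulas L" unfolding formulas_def by blast
  with q(2) have "(\<forall>e\<in>ext M q. sat M e (Neg (rename ((!) ?v) \<psi>))) \<longrightarrow>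
    sat G d (Neg (rename ((!) ?v) \<psi>))" by blast
  then have "\<not> holds G \<psi> (map d ?v)"
    using \<psi>(2) unfolding holds_map[OF \<psi>_fm(1), of G d] by (simp only: sat.simps simp_thms)
  moreover have "holds G \<psi> (map g t)"
    using isomorphism_holds[OF g A(1) \<psi>_fm(2)] \<psi>_fm(3) t_tuple by (simp add: tuples_def)
  ultimately show False unfolding v by blast
qed


section \<open>Types and orbits\<close>

text \<open>A point of a finite set of types is separated from each of the others by a formula, and the
  conjunction of these finitely many formulas isolates it.\<close>

lemma isolating_formula:
  fixes M :: "('f, 'r, 'a) struct"
  assumes fin: "finite (type_of L M ` tuples n (univ M))" and as: "as \<in> tuples n (univ M)"
  obtains \<theta> where "is_fm L n \<theta>" "holds M \<theta> as"
    "\<forall>bs\<in>tuples n (univ M). holds M \<theta> bs \<longrightarrow> type_of L M bs = type_of L M as"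
proof -
  let ?Q = "type_of L M ` tuples n (univ M) - {type_of L M as}"
  have "\<forall>q\<in>?Q. \<exists>\<psi>. is_fm L n \<psi> \<and> holds M \<psi> as \<and> \<psi> \<notin> q"
  proof
    fix q assume "q \<in> ?Q"
    then obtain bs where bs: "bs \<in> tuples n (univ M)" "q = type_of L M bs" "type_of L M bs \<noteq> type_of L M as"
      by blast
    then obtain \<phi> where \<phi>: "is_fm L n \<phi>" "holds M \<phi> bs \<noteq> holds M \<phi> as"
      using type_of_eq_iff[OF bs(1) as] by blast
    show "\<exists>\<psi>. is_fm L n \<psi> \<and> holds M \<psi> as \<and> \<psi> \<notin> q"
    proof (cases "holds M \<phi> as")
      case True
      with \<phi> bs(2) show ?thesis by (intro exI[of _ \<phi>]) (simp add: type_of_def)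
    next
      case False
      with \<phi> bs(2) show ?thesis by (intro exI[of _ "Neg \<phi>"]) (simp add: type_of_def)
    qed
  qed
  from bchoice[OF this] obtain \<psi> where
    \<psi>: "\<forall>q\<in>?Q. is_fm L n (\<psi> q) \<and> holds M (\<psi> q) as \<and> \<psi> q \<notin> q" by (elim exE)
  have fin_img: "finite (\<psi> ` ?Q)" using fin by simp
  note holds_\<theta> = holds_conj_set[OF fin_img]
  show thesis
  proof
    show "is_fm L n (conj_set (\<psi> ` ?Q))" unfolding is_fm_conj_set[OF fin_img] using \<psi> by blast
    show "holds M (conj_set (\<psi> ` ?Q)) as" unfolding holds_\<theta> using \<psi> by blast
    show "\<forall>bs\<in>tuples n (univ M). holds M (conj_set (\<psi> ` ?Q)) bs \<longrightarrow> type_of L M bs = type_of L M as"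
    proof (intro ballI impI, rule ccontr)
      fix bs assume bs: "bs \<in> tuples n (univ M)" "holds M (conj_set (\<psi> ` ?Q)) bs"
      assume "type_of L M bs \<noteq> type_of L M as"
      then have q: "type_of L M bs \<in> ?Q" using bs(1) by blast
      then have "holds M (\<psi> (type_of L M bs)) bs" using bs(2) unfolding holds_\<theta> by blast
      moreover have "is_fm L n (\<psi> (type_of L M bs))" using \<psi> q by blast
      ultimately have "\<psi> (type_of L M bs) \<in> type_of L M bs"
        using bs(1) by (simp add: type_of_def tuples_def)
      then show False using \<psi> q by blast
    qed
  qed
qed

text \<open>The one-step extension property behind back-and-forth: if \<open>\<theta>\<close> isolates the type of \<open>as @ [x]\<close>, then
  \<open>\<exists>z. \<theta>(y, z)\<close> belongs to the common type of \<open>as\<close> and \<open>bs\<close>.\<close>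

lemma type_extension:
  fixes M :: "('f, 'r, 'a) struct"
  assumes fin: "finite (type_of L M ` tuples (Suc n) (univ M))"
    and as: "as \<in> tuples n (univ M)" and bs: "bs \<in> tuples n (univ M)"
    and eq: "type_of L M as = type_of L M bs" and x: "x \<in> univ M"
  obtains y where "y \<in> univ M" "type_of L M (as @ [x]) = type_of L M (bs @ [y])"
proof -
  have ext_tuple: "cs @ [z] \<in> tuples (Suc n) (univ M)" if "cs \<in> tuples n (univ M)" "z \<in> univ M" for cs z
    using that by (simp add: tuples_def)
  obtain \<theta> where \<theta>: "is_fm L (Suc n) \<theta>" "holds M \<theta> (as @ [x])"
    "\<forall>cs\<in>tuples (Suc n) (univ M). holds M \<theta> cs \<longrightarrow> type_of L M cs = type_of L M (as @ [x])"
    by (rule isolating_formula[OF fin ext_tuple[OF as x]])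
  let ?r = "\<lambda>i. if i < n then Suc i else 0"
  let ?\<chi> = "Exists (rename ?r \<theta>)"
  have "is_fm L (Suc n) (rename ?r \<theta>)" by (rule is_fm_rename[OF \<theta>(1)]) simp
  then have fm: "is_fm L n ?\<chi>" by simp
  have \<chi>: "holds M ?\<chi> cs \<longleftrightarrow> (\<exists>z\<in>univ M. holds M \<theta> (cs @ [z]))" if "cs \<in> tuples n (univ M)" for cs
  proof -
    have "holds M (rename ?r \<theta>) (z # cs) \<longleftrightarrow> holds M \<theta> (cs @ [z])" for z
      unfolding holds_def sat_rename
      by (rule sat_cong[OF \<theta>(1)]) (use that in \<open>auto simp: tuples_def nth_append less_Suc_eq\<close>)
    then show ?thesis by simp
  qed
  have "holds M ?\<chi> as" using \<theta>(2) x \<chi>[OF as] by blast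
  then have "holds M ?\<chi> bs" using eq fm type_of_eq_iff[OF as bs] by blast
  then obtain y where y: "y \<in> univ M" "holds M \<theta> (bs @ [y])" using \<chi>[OF bs] by blast
  have "type_of L M (bs @ [y]) = type_of L M (as @ [x])"
    using \<theta>(3) ext_tuple[OF bs y(1)] y(2) by blast
  then show thesis using y(1) that by metis
qed

text \<open>Back-and-forth is arranged to produce two enumerations of the universe with the same type in
  infinitely many variables. The automorphism is then read off from atomic formulas.\<close>

lemma automorphism_of_enumerations:
  fixes M :: "('f, 'r, 'a) struct"
  assumes M: "is_struct L M" and \<alpha>: "range \<alpha> = univ M" and \<beta>: "range \<beta> = univ M"
    and eq: "\<And>\<phi>. \<phi> \<in> formulas L \<Longrightarrow> sat M \<alpha> \<phi> \<longleftrightarrow> sat M \<beta> \<phi>"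
  obtains \<sigma> where "\<sigma> \<in> Aut L M" "\<And>i. \<sigma> (\<alpha> i) = \<beta> i"
proof -
  have eq_iff: "\<alpha> i = \<alpha> j \<longleftrightarrow> \<beta> i = \<beta> j" for i j
  proof -
    have "is_fm L (Suc (i + j)) (Eq (Var i) (Var j))" by simp
    then have "Eq (Var i) (Var j) \<in> formulas L" unfolding formulas_def by blast
    from eq[OF this] show ?thesis by simp
  qed
  define \<sigma> where "\<sigma> x = \<beta> (SOME i. \<alpha> i = x)" for x
  have \<sigma>: "\<sigma> (\<alpha> i) = \<beta> i" for i
  proof -
    have "\<alpha> (SOME j. \<alpha> j = \<alpha> i) = \<alpha> i" by (rule someI[of _ i]) simp
    then show ?thesis unfolding \<sigma>_def using eq_iff by blast
  qed
  have map_\<sigma>: "map \<sigma> (map \<alpha> js) = map \<beta> js" for js using \<sigma> by simp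
  have enum: "\<exists>js. xs = map \<alpha> js" if "xs \<in> tuples k (univ M)" for xs k
    using that unfolding ex_map_conv tuples_def \<alpha>[symmetric] by blast
  have bound: "\<exists>k. \<forall>j\<in>set js. j < k" for js :: "nat list"
    using finite_nat_set_iff_bounded[of "set js"] by simp
  have "\<sigma> ` univ M = univ M" unfolding \<alpha>[symmetric] image_image \<sigma> using \<alpha> \<beta> by simp
  moreover have "inj_on \<sigma> (univ M)" unfolding \<alpha>[symmetric] inj_on_def using \<sigma> eq_iff by auto
  moreover have "\<sigma> (fint M f xs) = fint M f (map \<sigma> xs)"
    if f: "f \<in> funs L" and xs: "xs \<in> tuples (farity L f) (univ M)" for f xs
  proof -
    obtain js where js: "xs = map \<alpha> js" using enum[OF xs] by blast
    have "fint M f xs \<in> range \<alpha>" unfolding \<alpha> using M f xs by (rule fint_closed)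
    then obtain j where j: "fint M f xs = \<alpha> j" by blast
    obtain k where "\<forall>i\<in>set js. i < k" using bound by blast
    moreover have "length js = farity L f" using xs js by (simp add: tuples_def)
    ultimately have "is_fm L (max k (Suc j)) (Eq (Fn f (map Var js)) (Var j))"
      using f by auto
    then have "Eq (Fn f (map Var js)) (Var j) \<in> formulas L" unfolding formulas_def by blast
    from eq[OF this] j js have "fint M f (map \<beta> js) = \<beta> j" by (simp add: comp_def)
    moreover have "map \<sigma> xs = map \<beta> js" unfolding js by (rule map_\<sigma>)
    ultimately show ?thesis unfolding j \<sigma> by simp
  qed
  moreover have "xs \<in> rint M r \<longleftrightarrow> map \<sigma> xs \<in> rint M r"
    if r: "r \<in> rels L" and xs: "xs \<in> tuples (rarity L r) (univ M)" for r xs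
  proof -
    obtain js where js: "xs = map \<alpha> js" using enum[OF xs] by blast
    obtain k where "\<forall>i\<in>set js. i < k" using bound by blast
    moreover have "length js = rarity L r" using xs js by (simp add: tuples_def)
    ultimately have "is_fm L k (Rel r (map Var js))" using r by auto
    then have "Rel r (map Var js) \<in> formulas L" unfolding formulas_def by blast
    from eq[OF this] show ?thesis unfolding js map_\<sigma> by (simp add: comp_def)
  qed
  ultimately have "\<sigma> \<in> Aut L M" by (simp add: Aut_def isomorphism_def bij_betw_def)
  then show thesis using \<sigma> by (rule that)
qed

lemma same_type_same_orbit:
  fixes M :: "('f, 'r, 'a) struct"
  assumes M: "is_struct L M" and count: "countable (univ M)"
    and fin: "\<And>n. finite (type_of L M ` tuples n (univ M))"
    and as: "as \<in> tuples n (univ M)" and bs: "bs \<in> tuples n (univ M)"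
    and eq: "type_of L M as = type_of L M bs"
  shows "same_orbit (Aut L M) as bs"
proof -
  define en where "en = from_nat_into (univ M)"
  have ne: "univ M \<noteq> {}" using M by (simp add: is_struct_def)
  have en: "range en = univ M" unfolding en_def by (rule range_from_nat_into[OF ne count])
  \<comment> \<open>stage \<open>s\<close> has processed \<open>s\<close> elements of an enumeration of the universe in both directions, adding two
    entries to both tuples for each of them\<close>
  define P where "P s p \<longleftrightarrow> fst p \<in> tuples (n + 2 * s) (univ M) \<and> snd p \<in> tuples (n + 2 * s) (univ M) \<and>
    type_of L M (fst p) = type_of L M (snd p) \<and> (s = 0 \<longrightarrow> p = (as, bs))" for s and p :: "'a list \<times> 'a list"
  define Q where "Q s p p' \<longleftrightarrow> (\<exists>x y. fst p' = fst p @ [en s, x] \<and> snd p' = snd p @ [y, en s])"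
    for s and p p' :: "'a list \<times> 'a list"
  have "\<exists>p'. P (Suc s) p' \<and> Q s p p'" if p: "P s p" for s p
  proof -
    have en_s: "en s \<in> univ M" using en by blast
    obtain y where y: "y \<in> univ M" "type_of L M (fst p @ [en s]) = type_of L M (snd p @ [y])"
      using type_extension[OF fin _ _ _ en_s, of "fst p" "n + 2 * s" "snd p"] p unfolding P_def by blast
    have 1: "fst p @ [en s] \<in> tuples (Suc (n + 2 * s)) (univ M)"
      "snd p @ [y] \<in> tuples (Suc (n + 2 * s)) (univ M)"
      using p y(1) en_s by (simp_all add: P_def tuples_def)
    obtain x where x: "x \<in> univ M"
      "type_of L M ((snd p @ [y]) @ [en s]) = type_of L M ((fst p @ [en s]) @ [x])"
      using type_extension[OF fin 1(2) 1(1) y(2)[symmetric] en_s] .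
    let ?p = "(fst p @ [en s, x], snd p @ [y, en s])"
    have "P (Suc s) ?p" using 1 x en_s by (simp add: P_def tuples_def)
    moreover have "Q s p ?p" by (simp add: Q_def)
    ultimately show ?thesis by blast
  qed
  moreover have "P 0 (as, bs)" using as bs eq by (simp add: P_def)
  ultimately obtain p where p: "\<And>s. P s (p s)" and step: "\<And>s. Q s (p s) (p (Suc s))"
    using dependent_nat_choice[of P Q] by blast
  have len: "length (fst (p s)) = n + 2 * s" "length (snd (p s)) = n + 2 * s" for s
    using p[of s] by (simp_all add: P_def tuples_def)
  have stable: "s \<le> t \<Longrightarrow> i < n + 2 * s \<Longrightarrow>
      fst (p t) ! i = fst (p s) ! i \<and> snd (p t) ! i = snd (p s) ! i" for s t i
  proof (induction rule: dec_induct)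
    case (step t)
    obtain x y where "fst (p (Suc t)) = fst (p t) @ [en t, x]" "snd (p (Suc t)) = snd (p t) @ [y, en t]"
      using \<open>\<And>s. Q s (p s) (p (Suc s))\<close>[of t] unfolding Q_def by blast
    moreover have "i < n + 2 * t" using step by linarith
    ultimately show ?case using step by (simp add: nth_append len)
  qed simp
  \<comment> \<open>entry \<open>i\<close> is present from stage \<open>i + 1\<close> at the latest and does not change later\<close>
  define \<alpha> where "\<alpha> i = fst (p (Suc i)) ! i" for i
  define \<beta> where "\<beta> i = snd (p (Suc i)) ! i" for i
  have \<alpha>\<beta>: "fst (p s) ! i = \<alpha> i \<and> snd (p s) ! i = \<beta> i" if "i < n + 2 * s" for s i
    using stable[of s "Suc i" i] stable[of "Suc i" s i] that unfolding \<alpha>_def \<beta>_def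
    by (cases "s \<le> Suc i") auto
  have map_\<alpha>: "map \<alpha> [0..<n + 2 * s] = fst (p s)" and map_\<beta>: "map \<beta> [0..<n + 2 * s] = snd (p s)" for s
    using \<alpha>\<beta>[of _ s] by (simp_all add: list_eq_iff_nth_eq len)
  have in_univ: "fst (p s) ! i \<in> univ M \<and> snd (p s) ! i \<in> univ M" if "i < n + 2 * s" for s i
  proof -
    have "set (fst (p s)) \<subseteq> univ M" "set (snd (p s)) \<subseteq> univ M"
      using p[of s] by (simp_all add: P_def tuples_def)
    moreover have "fst (p s) ! i \<in> set (fst (p s))" "snd (p s) ! i \<in> set (snd (p s))"
      using that len[of s] by (simp_all add: nth_mem)
    ultimately show ?thesis by blast
  qed
  have onto: "\<alpha> (n + 2 * s) = en s" "\<beta> (Suc (n + 2 * s)) = en s" for s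
  proof -
    obtain x y where xy: "fst (p (Suc s)) = fst (p s) @ [en s, x]" "snd (p (Suc s)) = snd (p s) @ [y, en s]"
      using step[of s] unfolding Q_def by blast
    show "\<alpha> (n + 2 * s) = en s" "\<beta> (Suc (n + 2 * s)) = en s"
      using \<alpha>\<beta>[of "n + 2 * s" "Suc s"] \<alpha>\<beta>[of "Suc (n + 2 * s)" "Suc s"] unfolding xy
      by (simp_all add: nth_append len)
  qed
  have maps: "\<alpha> i \<in> univ M" "\<beta> i \<in> univ M" for i
    using in_univ[of i "Suc i"] unfolding \<alpha>_def \<beta>_def by simp_all
  have "univ M \<subseteq> range \<alpha>" "univ M \<subseteq> range \<beta>"
    unfolding en[symmetric] using onto by (metis image_subsetI rangeI)+
  then have "range \<alpha> = univ M" "range \<beta> = univ M" using maps by blast+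
  moreover have "sat M \<alpha> \<phi> \<longleftrightarrow> sat M \<beta> \<phi>" if "\<phi> \<in> formulas L" for \<phi>
  proof -
    obtain k where "is_fm L k \<phi>" using \<open>\<phi> \<in> formulas L\<close> unfolding formulas_def by blast
    then have fm: "is_fm L (n + 2 * k) \<phi>" by (rule is_fm_mono) simp
    have "fst (p k) \<in> tuples (n + 2 * k) (univ M)" "snd (p k) \<in> tuples (n + 2 * k) (univ M)"
      "type_of L M (fst (p k)) = type_of L M (snd (p k))" using p[of k] by (simp_all add: P_def)
    then have "holds M \<phi> (fst (p k)) \<longleftrightarrow> holds M \<phi> (snd (p k))"
      using type_of_eq_iff fm by blast
    then show ?thesis using holds_upt[OF fm, of M \<alpha>] holds_upt[OF fm, of M \<beta>] map_\<alpha>[of k] map_\<beta>[of k]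
      by simp
  qed
  ultimately obtain \<sigma> where \<sigma>: "\<sigma> \<in> Aut L M" "\<And>i. \<sigma> (\<alpha> i) = \<beta> i"
    using automorphism_of_enumerations[OF M] by blast
  have "p 0 = (as, bs)" using p[of 0] by (simp add: P_def)
  then have "map \<alpha> [0..<n] = as" "map \<beta> [0..<n] = bs" using map_\<alpha>[of 0] map_\<beta>[of 0] by simp_all
  then have "map \<sigma> as = bs" using \<sigma>(2) by (auto simp: comp_def)
  then show ?thesis using \<sigma>(1) unfolding same_orbit_def by blast
qed


section \<open>Homogeneous substructures and approximation\<close>

text \<open>This extends the homogeneity condition to the empty tuple, where the identity serves as the automorphism.\<close>

lemma homogeneous_substruct_orbit:
  assumes "homogeneous_substruct L N M" "as \<in> tuples n (univ N)" "bs \<in> tuples n (univ N)"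
    "same_orbit (Aut L M) as bs"
  shows "same_orbit (Aut_setwise L M (univ N)) as bs"
proof (cases "n = 0")
  case True
  have "id \<in> Aut_setwise L M (univ N)"
    by (auto simp: Aut_setwise_def Aut_def isomorphism_def)
  then show ?thesis using True assms(2,3) unfolding same_orbit_def by auto
next
  case False
  then have "1 \<le> n" by simp
  then show ?thesis using assms unfolding homogeneous_substruct_def by blast
qed

text \<open>The automorphism restricts to one of \<open>N\<close>, which maps the solutions over \<open>as\<close> bijectively onto those
  over \<open>bs\<close>.\<close>

lemma card_solutions_orbit:
  assumes sub: "substruct L N M" and fm: "is_fm L (n + m) \<phi>"
    and as: "as \<in> tuples m (univ N)" and orbit: "same_orbit (Aut_setwise L M (univ N)) as bs"
  shows "card (solutions \<phi> N n as) = card (solutions \<phi> N n bs)"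
proof -
  obtain \<sigma> where \<sigma>: "isomorphism L M M \<sigma>" "\<sigma> ` univ N = univ N" "map \<sigma> as = bs"
    using orbit by (auto simp: same_orbit_def Aut_setwise_def Aut_def)
  have N: "is_struct L N" "univ N \<subseteq> univ M" using sub by (simp_all add: substruct_def)
  have tuples_mono: "xs \<in> tuples k (univ M)" if "xs \<in> tuples k (univ N)" for xs k
    using that N(2) by (auto simp: tuples_def)
  have map_tuples: "map \<sigma> xs \<in> tuples k (univ N)" if "xs \<in> tuples k (univ N)" for xs k
    using that \<sigma>(2) by (auto simp: tuples_def)
  have "inj_on \<sigma> (univ M)" using \<sigma>(1) by (simp add: isomorphism_def bij_betw_def)
  then have inj: "inj_on \<sigma> (univ N)" using N(2) by (rule inj_on_subset)
  have "isomorphism L N N \<sigma>"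
    unfolding isomorphism_def
  proof (intro conjI ballI)
    show "bij_betw \<sigma> (univ N) (univ N)" using inj \<sigma>(2) by (simp add: bij_betw_def)
  next
    fix f xs assume f: "f \<in> funs L" and xs: "xs \<in> tuples (farity L f) (univ N)"
    have "fint N f xs = fint M f xs" "fint N f (map \<sigma> xs) = fint M f (map \<sigma> xs)"
      using sub f xs map_tuples[OF xs] by (simp_all add: substruct_def)
    moreover have "\<sigma> (fint M f xs) = fint M f (map \<sigma> xs)"
      using \<sigma>(1) f tuples_mono[OF xs] by (simp add: isomorphism_def)
    ultimately show "\<sigma> (fint N f xs) = fint N f (map \<sigma> xs)" by simp
  next
    fix r xs assume r: "r \<in> rels L" and xs: "xs \<in> tuples (rarity L r) (univ N)"
    have "xs \<in> rint N r \<longleftrightarrow> xs \<in> rint M r" "map \<sigma> xs \<in> rint N r \<longleftrightarrow> map \<sigma> xs \<in> rint M r"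
      using sub r xs map_tuples[OF xs] unfolding substruct_def by blast+
    moreover have "xs \<in> rint M r \<longleftrightarrow> map \<sigma> xs \<in> rint M r"
      using \<sigma>(1) r tuples_mono[OF xs] unfolding isomorphism_def by blast
    ultimately show "xs \<in> rint N r \<longleftrightarrow> map \<sigma> xs \<in> rint N r" by blast
  qed
  then have holds: "holds N \<phi> (map \<sigma> cs @ bs) \<longleftrightarrow> holds N \<phi> (cs @ as)" if "cs \<in> tuples n (univ N)" for cs
    using isomorphism_holds[of L N N \<sigma> "cs @ as" \<phi>] N(1) fm as that \<sigma>(3) by (simp add: tuples_def)
  have "map \<sigma> ` solutions \<phi> N n as = solutions \<phi> N n bs"
  proof
    show "map \<sigma> ` solutions \<phi> N n as \<subseteq> solutions \<phi> N n bs"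
      using holds map_tuples by (auto simp: solutions_def)
    show "solutions \<phi> N n bs \<subseteq> map \<sigma> ` solutions \<phi> N n as"
    proof
      fix ds assume ds: "ds \<in> solutions \<phi> N n bs"
      then have "\<forall>d\<in>set ds. \<exists>c\<in>univ N. d = \<sigma> c"
        using \<sigma>(2) by (auto simp: solutions_def tuples_def)
      then obtain h where h: "\<forall>d\<in>set ds. h d \<in> univ N \<and> d = \<sigma> (h d)" by metis
      have ds_eq: "map \<sigma> (map h ds) = ds" using h by (simp add: map_idI)
      have "map h ds \<in> tuples n (univ N)" using ds h by (auto simp: solutions_def tuples_def)
      then have "map h ds \<in> solutions \<phi> N n as"
        using holds[of "map h ds"] ds unfolding ds_eq solutions_def by blast
      then show "ds \<in> map \<sigma> ` solutions \<phi> N n as" using ds_eq by (metis imageI)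
    qed
  qed
  moreover have "inj_on (map \<sigma>) (solutions \<phi> N n as)"
    by (rule inj_on_subset[OF inj_on_map_lists[OF inj]]) (auto simp: solutions_def tuples_def)
  ultimately show ?thesis using card_image by metis
qed

lemma substruct_trm_val:
  assumes sub: "substruct L N M" and t: "is_trm L n t" and e: "\<And>i. i < n \<Longrightarrow> e i \<in> univ N"
  shows "trm_val N e t \<in> univ N \<and> trm_val N e t = trm_val M e t"
  using t
proof (induction t)
  case (Var x)
  then show ?case using e by simp
next
  case (Fn f ts)
  have IH: "\<forall>t\<in>set ts. trm_val N e t \<in> univ N \<and> trm_val N e t = trm_val M e t"
    by (intro ballI Fn.IH) (use Fn.prems in simp_all)
  have f: "f \<in> funs L" using Fn.prems by simp
  have map_eq: "map (trm_val N e) ts = map (trm_val M e) ts" using IH by simp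
  have tup: "map (trm_val N e) ts \<in> tuples (farity L f) (univ N)"
    using IH Fn.prems by (auto simp: tuples_def)
  have "is_struct L N" using sub by (simp add: substruct_def)
  then have "fint N f (map (trm_val N e) ts) \<in> univ N" using f tup by (rule fint_closed)
  moreover have "fint N f (map (trm_val N e) ts) = fint M f (map (trm_val N e) ts)"
    using sub f tup unfolding substruct_def by blast
  ultimately show ?case by (simp only: trm_val.simps map_eq)
qed

lemma smoothly_approximated_mono:
  assumes "smoothly_approximated L M Ms" "i \<le> j"
  shows "univ (Ms i) \<subseteq> univ (Ms j)"
  using assms(1) by (intro lift_Suc_mono_le[OF _ assms(2)]) (simp add: smoothly_approximated_def)

lemma finite_subset_approximation:
  assumes approx: "smoothly_approximated L M Ms" and X: "finite X" "X \<subseteq> univ M"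
  shows "\<exists>i. X \<subseteq> univ (Ms i)"
  using X
proof (induction X)
  case (insert x X)
  then obtain i where i: "X \<subseteq> univ (Ms i)" by blast
  have "(\<Union>i. univ (Ms i)) = univ M" using approx by (simp add: smoothly_approximated_def)
  then obtain j where j: "x \<in> univ (Ms j)" using insert.prems by blast
  have "insert x X \<subseteq> univ (Ms (max i j))"
    using i j smoothly_approximated_mono[OF approx, of i "max i j"]
      smoothly_approximated_mono[OF approx, of j "max i j"] by auto
  then show ?case by blast
qed simp

text \<open>By induction on formulas; only the quantifier is of interest. There are finitely many types of
  parameter tuples, so one representative and one witness (if there is any) for each of them all lie in
  some \<open>M\<^sub>i\<close>, and in all later ones. A tuple of \<open>M\<^sub>i\<close> of a given type is the image of the representative
  under an automorphism of \<open>M\<close> that preserves \<open>M\<^sub>i\<close>, so the image of the witness is a witness in \<open>M\<^sub>i\<close>.\<close>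

lemma eventually_absolute:
  fixes M :: "('f, 'r, 'a) struct"
  assumes approx: "smoothly_approximated L M Ms"
    and fin: "\<And>n. finite (type_of L M ` tuples n (univ M))"
    and orbit: "\<And>n as bs. as \<in> tuples n (univ M) \<Longrightarrow> bs \<in> tuples n (univ M) \<Longrightarrow>
      type_of L M as = type_of L M bs \<Longrightarrow> same_orbit (Aut L M) as bs"
    and fm: "is_fm L n \<phi>"
  shows "\<exists>i0. \<forall>i\<ge>i0. \<forall>as\<in>tuples n (univ (Ms i)). holds (Ms i) \<phi> as \<longleftrightarrow> holds M \<phi> as"
proof -
  have sub: "substruct L (Ms i) M" for i
    using approx by (simp add: smoothly_approximated_def homogeneous_substruct_def)
  have trm: "trm_val (Ms i) ((!) as) t \<in> univ (Ms i) \<and> trm_val (Ms i) ((!) as) t = trm_val M ((!) as) t"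
    if "is_trm L n t" "as \<in> tuples n (univ (Ms i))" for n t i as
    using that(2) by (intro substruct_trm_val[OF sub that(1)]) (auto simp: tuples_def)
  show ?thesis
    using fm
  proof (induction \<phi> arbitrary: n)
    case (Eq s t)
    have st: "is_trm L n s" "is_trm L n t" using Eq.prems by simp_all
    show ?case unfolding holds_def using trm[OF st(1)] trm[OF st(2)] by simp
  next
    case (Rel r ts)
    have "holds (Ms i) (Rel r ts) as \<longleftrightarrow> holds M (Rel r ts) as" if as: "as \<in> tuples n (univ (Ms i))" for i as
    proof -
      have ts: "\<forall>t\<in>set ts. trm_val (Ms i) ((!) as) t \<in> univ (Ms i) \<and>
          trm_val (Ms i) ((!) as) t = trm_val M ((!) as) t"
        by (intro ballI trm[OF _ as]) (use Rel.prems in simp)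
      then have map_eq: "map (trm_val (Ms i) ((!) as)) ts = map (trm_val M ((!) as)) ts" by simp
      have "map (trm_val (Ms i) ((!) as)) ts \<in> tuples (rarity L r) (univ (Ms i))"
        using ts Rel.prems by (auto simp: tuples_def)
      moreover have "r \<in> rels L" using Rel.prems by simp
      ultimately have "map (trm_val (Ms i) ((!) as)) ts \<in> rint (Ms i) r \<longleftrightarrow>
          map (trm_val (Ms i) ((!) as)) ts \<in> rint M r"
        using sub[of i] unfolding substruct_def by blast
      then show ?thesis unfolding holds_def by (simp only: sat.simps map_eq)
    qed
    then show ?case by blast
  next
    case (Neg \<phi>)
    then show ?case by simp
  next
    case (Conj \<phi> \<psi>)
    have "is_fm L n \<phi>" "is_fm L n \<psi>" using Conj.prems by simp_all
    from Conj.IH(1)[OF this(1)] Conj.IH(2)[OF this(2)] obtain i j where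
      i: "\<forall>k\<ge>i. \<forall>as\<in>tuples n (univ (Ms k)). holds (Ms k) \<phi> as \<longleftrightarrow> holds M \<phi> as" and
      j: "\<forall>k\<ge>j. \<forall>as\<in>tuples n (univ (Ms k)). holds (Ms k) \<psi> as \<longleftrightarrow> holds M \<psi> as"
      by (elim exE)
    show ?case by (rule exI[of _ "max i j"]) (use i j in simp)
  next
    case (Exists \<phi>)
    have fm: "is_fm L (Suc n) \<phi>" using Exists.prems by simp
    from Exists.IH[OF this] obtain i1 where
      i1: "\<forall>i\<ge>i1. \<forall>as\<in>tuples (Suc n) (univ (Ms i)). holds (Ms i) \<phi> as \<longleftrightarrow> holds M \<phi> as" by (elim exE)
    let ?types = "type_of L M ` tuples n (univ M)"
    have "\<forall>q\<in>?types. \<exists>p. fst p \<in> tuples n (univ M) \<and> type_of L M (fst p) = q \<and> snd p \<in> univ M \<and>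
        (holds M (Exists \<phi>) (fst p) \<longrightarrow> holds M \<phi> (snd p # fst p))"
    proof
      fix q assume "q \<in> ?types"
      then obtain as where as: "as \<in> tuples n (univ M)" "type_of L M as = q" by blast
      show "\<exists>p. fst p \<in> tuples n (univ M) \<and> type_of L M (fst p) = q \<and> snd p \<in> univ M \<and>
        (holds M (Exists \<phi>) (fst p) \<longrightarrow> holds M \<phi> (snd p # fst p))"
      proof (cases "holds M (Exists \<phi>) as")
        case True
        then obtain x where "x \<in> univ M" "holds M \<phi> (x # as)" by auto
        then show ?thesis using as by (intro exI[of _ "(as, x)"]) simp
      next
        case False
        obtain x where "x \<in> univ M" using sub[of 0] by (auto simp: substruct_def is_struct_def)
        then show ?thesis using as False by (intro exI[of _ "(as, x)"]) simp
      qed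
    qed
    from bchoice[OF this] obtain w where
      w: "\<forall>q\<in>?types. fst (w q) \<in> tuples n (univ M) \<and> type_of L M (fst (w q)) = q \<and> snd (w q) \<in> univ M \<and>
        (holds M (Exists \<phi>) (fst (w q)) \<longrightarrow> holds M \<phi> (snd (w q) # fst (w q)))" by (elim exE)
    define X where "X = (\<Union>q\<in>?types. insert (snd (w q)) (set (fst (w q))))"
    have "finite X" unfolding X_def by (rule finite_UN_I[OF fin]) simp
    moreover have "X \<subseteq> univ M" using w unfolding X_def tuples_def by blast
    ultimately obtain i2 where i2: "X \<subseteq> univ (Ms i2)" using finite_subset_approximation[OF approx] by blast
    have "holds (Ms i) (Exists \<phi>) as \<longleftrightarrow> holds M (Exists \<phi>) as"
      if i: "i \<ge> max i1 i2" and as: "as \<in> tuples n (univ (Ms i))" for i as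
    proof -
      have i_sub: "univ (Ms i) \<subseteq> univ M" using sub[of i] by (simp add: substruct_def)
      have X_sub: "X \<subseteq> univ (Ms i)" using i2 smoothly_approximated_mono[OF approx, of i2 i] i by auto
      have as_M: "as \<in> tuples n (univ M)" using as i_sub by (auto simp: tuples_def)
      have IH: "holds (Ms i) \<phi> (x # as) \<longleftrightarrow> holds M \<phi> (x # as)" if "x \<in> univ (Ms i)" for x
        using i1 i as that by (simp add: tuples_def)
      show ?thesis
      proof
        assume "holds (Ms i) (Exists \<phi>) as"
        then show "holds M (Exists \<phi>) as" using IH i_sub by auto
      next
        assume ex: "holds M (Exists \<phi>) as"
        define rs where "rs = fst (w (type_of L M as))"
        define x where "x = snd (w (type_of L M as))"
        have q: "type_of L M as \<in> ?types" using as_M by blast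
        have rs: "rs \<in> tuples n (univ M)" "type_of L M rs = type_of L M as"
          and x: "x \<in> univ M" "holds M (Exists \<phi>) rs \<longrightarrow> holds M \<phi> (x # rs)"
          using w q unfolding rs_def x_def by blast+
        have "insert x (set rs) \<subseteq> X" unfolding X_def rs_def x_def using q by blast
        then have x_i: "x \<in> univ (Ms i)" and rs_i: "rs \<in> tuples n (univ (Ms i))"
          using X_sub rs(1) unfolding tuples_def by blast+
        have "holds M (Exists \<phi>) rs"
          using ex Exists.prems rs(2) type_of_eq_iff[OF rs(1) as_M] by blast
        then have hx: "holds M \<phi> (x # rs)" using x(2) by blast
        have "homogeneous_substruct L (Ms i) M" using approx by (simp add: smoothly_approximated_def)
        from homogeneous_substruct_orbit[OF this rs_i as orbit[OF rs(1) as_M rs(2)]]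
        obtain \<sigma> where \<sigma>: "isomorphism L M M \<sigma>" "\<sigma> ` univ (Ms i) = univ (Ms i)" "map \<sigma> rs = as"
          by (auto simp: same_orbit_def Aut_setwise_def Aut_def)
        have "is_struct L M" using sub[of i] by (simp add: substruct_def)
        from isomorphism_holds[OF \<sigma>(1) this, of "x # rs" \<phi>]
        have "holds M \<phi> (\<sigma> x # as)" using fm hx x(1) rs(1) \<sigma>(3) by (simp add: tuples_def)
        moreover have "\<sigma> x \<in> univ (Ms i)" using \<sigma>(2) x_i by blast
        ultimately show "holds (Ms i) (Exists \<phi>) as" using IH by auto
      qed
    qed
    then show ?case by blast
  qed
qed

text \<open>A cell prescribes the truth values of the formulas of \<open>F\<close>, so a conjunction of such formulas and
  negations of such formulas defines it. It may contain tuples of different structures.\<close>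

lemma definable_partition_of_formulas:
  fixes C :: "('f, 'r, 'a) struct set"
  assumes F: "finite F" "\<And>\<chi>. \<chi> \<in> F \<Longrightarrow> is_fm L m \<chi>"
  obtains \<Phi> where "finite \<Phi>" "definable_partition L C m \<Phi>"
    "\<forall>\<pi>\<in>\<Phi>. \<forall>N as N' bs. (N, as) \<in> \<pi> \<longrightarrow> (N', bs) \<in> \<pi> \<longrightarrow> (\<forall>\<chi>\<in>F. holds N \<chi> as \<longleftrightarrow> holds N' \<chi> bs)"
proof -
  define cell where "cell S = {(N, as) \<in> pointed C m. \<forall>\<chi>\<in>F. holds N \<chi> as \<longleftrightarrow> \<chi> \<in> S}" for S
  define \<Phi> where "\<Phi> = cell ` Pow F - {{}}"
  have "finite \<Phi>" using F(1) by (simp add: \<Phi>_def)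
  moreover have "partition_on (pointed C m) \<Phi>"
  proof (rule partition_onI)
    show "\<Union> \<Phi> = pointed C m"
    proof
      show "\<Union> \<Phi> \<subseteq> pointed C m" unfolding \<Phi>_def cell_def by blast
      show "pointed C m \<subseteq> \<Union> \<Phi>"
      proof
        fix p assume p: "p \<in> pointed C m"
        obtain N as where Nas: "p = (N, as)" by (cases p)
        have "p \<in> cell {\<chi> \<in> F. holds N \<chi> as}" using p by (simp add: cell_def Nas)
        moreover have "{\<chi> \<in> F. holds N \<chi> as} \<in> Pow F" by blast
        ultimately show "p \<in> \<Union> \<Phi>" unfolding \<Phi>_def by blast
      qed
    qed
    show "disjnt p q" if "p \<in> \<Phi>" "q \<in> \<Phi>" "p \<noteq> q" for p q
    proof -
      obtain S S' where S: "p = cell S" "q = cell S'" "S \<subseteq> F" "S' \<subseteq> F"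
        using \<open>p \<in> \<Phi>\<close> \<open>q \<in> \<Phi>\<close> unfolding \<Phi>_def by blast
      have "S = S'" if "x \<in> cell S" "x \<in> cell S'" for x
        using that S(3,4) unfolding cell_def by blast
      then show ?thesis using \<open>p \<noteq> q\<close> S(1,2) unfolding disjnt_def by blast
    qed
    show "{} \<notin> \<Phi>" by (simp add: \<Phi>_def)
  qed
  moreover have "\<exists>\<psi>. is_fm L m \<psi> \<and> (\<forall>(N, as)\<in>pointed C m. (N, as) \<in> \<pi> \<longleftrightarrow> holds N \<psi> as)"
    if "\<pi> \<in> \<Phi>" for \<pi>
  proof -
    obtain S where S: "\<pi> = cell S" "S \<subseteq> F" using \<open>\<pi> \<in> \<Phi>\<close> unfolding \<Phi>_def by blast
    let ?G = "S \<union> Neg ` (F - S)"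
    have G: "finite ?G" using F(1) S(2) finite_subset by blast
    have "is_fm L m (conj_set ?G)"
      unfolding is_fm_conj_set[OF G] using F(2) S(2) by auto
    moreover have "(N, as) \<in> \<pi> \<longleftrightarrow> holds N (conj_set ?G) as" if "(N, as) \<in> pointed C m" for N as
    proof -
      have "holds N (conj_set ?G) as \<longleftrightarrow> (\<forall>\<chi>\<in>S. holds N \<chi> as) \<and> (\<forall>\<chi>\<in>F - S. \<not> holds N \<chi> as)"
        unfolding holds_conj_set[OF G] by (simp add: ball_Un)
      then show ?thesis using that S(2) unfolding S(1) cell_def by blast
    qed
    ultimately show ?thesis by blast
  qed
  ultimately have "definable_partition L C m \<Phi>" unfolding definable_partition_def by blast
  moreover have "\<forall>\<pi>\<in>\<Phi>. \<forall>N as N' bs. (N, as) \<in> \<pi> \<longrightarrow> (N', bs) \<in> \<pi> \<longrightarrow> (\<forall>\<chi>\<in>F. holds N \<chi> as \<longleftrightarrow> holds N' \<chi> bs)"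
    unfolding \<Phi>_def cell_def by blast
  ultimately show thesis using \<open>finite \<Phi>\<close> by (intro that)
qed

theorem proposition3p2p1:
  fixes L :: "('f, 'r) lang"
    and M :: "('f, 'r, 'a) struct"
    and Ms :: "nat \<Rightarrow> ('f, 'r, 'a) struct"
  assumes "countable (funs L)" and "countable (rels L)"
    and "smoothly_approximated L M Ms"
  shows "\<exists>R \<subseteq> range Ms \<rightarrow>\<^sub>E UNIV. is_mec L (range Ms) R"
proof (intro exI[of _ "range Ms \<rightarrow>\<^sub>E UNIV"] conjI subset_refl)
  note approx = assms(3)
  have cat: "aleph0_categorical L M" using approx by (simp add: smoothly_approximated_def)
  have M: "is_struct L M" using cat by (simp add: aleph0_categorical_def)
  have finM: "finite (univ (Ms i))" and hom: "homogeneous_substruct L (Ms i) M" for i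
    using approx by (simp_all add: smoothly_approximated_def)
  have sub: "substruct L (Ms i) M" for i using hom[of i] by (simp add: homogeneous_substruct_def)
  have "univ M = (\<Union>i. univ (Ms i))" using approx by (simp add: smoothly_approximated_def)
  then have count: "countable (univ M)" using finM by (simp add: countable_finite)
  note fin = finitely_many_types[OF cat assms(1,2)]
  note orbit = same_type_same_orbit[OF M count fin]
  show "is_mec L (range Ms) (range Ms \<rightarrow>\<^sub>E UNIV)"
    unfolding is_mec_def
  proof (intro conjI allI impI)
    show "\<forall>N\<in>range Ms. is_struct L N \<and> finite (univ N)"
      using sub finM by (auto simp: substruct_def)
  next
    fix n m :: nat and \<phi> :: "('f, 'r) fm"
    assume "1 \<le> n \<and> is_fm L (n + m) \<phi>"
    then have fm: "is_fm L (n + m) \<phi>" by simp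
    let ?types = "type_of L M ` tuples m (univ M)"
    have "\<forall>q\<in>?types. \<exists>\<theta>. is_fm L m \<theta> \<and> (\<forall>as\<in>tuples m (univ M). holds M \<theta> as \<longleftrightarrow> type_of L M as = q)"
    proof
      fix q assume "q \<in> ?types"
      then obtain as where as: "as \<in> tuples m (univ M)" "q = type_of L M as" by blast
      obtain \<theta> where \<theta>: "is_fm L m \<theta>" "holds M \<theta> as"
        "\<forall>bs\<in>tuples m (univ M). holds M \<theta> bs \<longrightarrow> type_of L M bs = type_of L M as"
        by (rule isolating_formula[OF fin as(1)])
      have "holds M \<theta> bs" if "bs \<in> tuples m (univ M)" "type_of L M bs = type_of L M as" for bs
        using type_of_eq_iff[OF that(1) as(1), of L M M] that(2) \<theta>(1,2) by blast
      then show "\<exists>\<theta>. is_fm L m \<theta> \<and> (\<forall>as\<in>tuples m (univ M). holds M \<theta> as \<longleftrightarrow> type_of L M as = q)"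
        using \<theta> as(2) by blast
    qed
    from bchoice[OF this] obtain \<theta> where
      \<theta>: "\<forall>q\<in>?types. is_fm L m (\<theta> q) \<and> (\<forall>as\<in>tuples m (univ M). holds M (\<theta> q) as \<longleftrightarrow> type_of L M as = q)"
      by (elim exE)
    have "\<forall>q\<in>?types. \<exists>i0. \<forall>i\<ge>i0. \<forall>as\<in>tuples m (univ (Ms i)). holds (Ms i) (\<theta> q) as \<longleftrightarrow> holds M (\<theta> q) as"
    proof
      fix q assume "q \<in> ?types"
      from bspec[OF \<theta> this] have fm: "is_fm L m (\<theta> q)" by (rule conjunct1)
      show "\<exists>i0. \<forall>i\<ge>i0. \<forall>as\<in>tuples m (univ (Ms i)). holds (Ms i) (\<theta> q) as \<longleftrightarrow> holds M (\<theta> q) as"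
        by (rule eventually_absolute[OF approx fin _ fm]) (rule orbit)
    qed
    from bchoice[OF this] obtain i0 where
      i0: "\<forall>q\<in>?types. \<forall>i\<ge>i0 q. \<forall>as\<in>tuples m (univ (Ms i)). holds (Ms i) (\<theta> q) as \<longleftrightarrow> holds M (\<theta> q) as"
      by (elim exE)
    \<comment> \<open>from \<open>I\<close> on all isolating formulas are absolute; \<open>K\<close> bounds the numbers of solutions before \<open>I\<close>\<close>
    define I where "I = (\<Sum>q\<in>?types. i0 q)"
    have I: "i0 q \<le> I" if "q \<in> ?types" for q
      unfolding I_def by (rule member_le_sum[OF that]) (simp_all add: fin)
    define K where "K = (\<Sum>i<I. card (tuples n (univ (Ms i))))"
    define F where "F = \<theta> ` ?types \<union> (\<lambda>k. at_least n k \<phi>) ` {..K}"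
    have F: "finite F" using fin[of m] by (simp add: F_def)
    have F_fm: "is_fm L m \<chi>" if "\<chi> \<in> F" for \<chi>
      using that \<theta> is_fm_at_least[OF fm] unfolding F_def by blast
    have count: "card (solutions \<phi> (Ms i) n as) = card (solutions \<phi> (Ms i) n bs)"
      if as: "as \<in> tuples m (univ (Ms i))" and bs: "bs \<in> tuples m (univ (Ms i))"
        and eq: "\<forall>\<chi>\<in>F. holds (Ms i) \<chi> as \<longleftrightarrow> holds (Ms i) \<chi> bs" for i as bs
    proof (cases "i < I")
      case False
      have i_sub: "univ (Ms i) \<subseteq> univ M" using sub[of i] by (simp add: substruct_def)
      have asM: "as \<in> tuples m (univ M)" and bsM: "bs \<in> tuples m (univ M)"
        using as bs i_sub by (auto simp: tuples_def)
      let ?q = "type_of L M as"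
      have q: "?q \<in> ?types" using asM by blast
      have "i0 ?q \<le> i" using I[OF q] False by simp
      then have abs: "holds (Ms i) (\<theta> ?q) cs \<longleftrightarrow> holds M (\<theta> ?q) cs" if "cs \<in> tuples m (univ (Ms i))" for cs
        using i0 q that by blast
      have "\<theta> ?q \<in> F" using q by (simp add: F_def)
      moreover have "holds M (\<theta> ?q) as" using \<theta> q asM by blast
      ultimately have "holds M (\<theta> ?q) bs" using eq abs[OF as] abs[OF bs] by blast
      then have "type_of L M as = type_of L M bs" using \<theta> q bsM by blast
      from homogeneous_substruct_orbit[OF hom as bs orbit[OF asM bsM this]]
      show ?thesis by (rule card_solutions_orbit[OF sub fm as])
    next
      case True
      have bound: "finite (solutions \<phi> (Ms i) n cs) \<and> card (solutions \<phi> (Ms i) n cs) \<le> K" for cs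
      proof -
        have fin_t: "finite (tuples n (univ (Ms i)))" by (rule finite_tuples[OF finM])
        have sub_t: "solutions \<phi> (Ms i) n cs \<subseteq> tuples n (univ (Ms i))" by (auto simp: solutions_def)
        have "card (tuples n (univ (Ms i))) \<le> K"
          unfolding K_def by (rule member_le_sum) (use True in simp_all)
        then show ?thesis using card_mono[OF fin_t sub_t] finite_subset[OF sub_t fin_t] by simp
      qed
      have at_least: "holds (Ms i) (at_least n k \<phi>) cs \<longleftrightarrow> k \<le> card (solutions \<phi> (Ms i) n cs)" for k cs
        unfolding holds_at_least using bound[of cs] card_mono obtain_subset_with_card_n by metis
      have "k \<le> card (solutions \<phi> (Ms i) n as) \<longleftrightarrow> k \<le> card (solutions \<phi> (Ms i) n bs)" if "k \<le> K" for k
      proof -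
        have "at_least n k \<phi> \<in> F" using that by (simp add: F_def)
        then show ?thesis using eq unfolding at_least[symmetric] by blast
      qed
      then show ?thesis using bound[of as] bound[of bs] by (meson dual_order.antisym order_refl)
    qed
    obtain \<Phi> where \<Phi>: "finite \<Phi>" "definable_partition L (range Ms) m \<Phi>"
      "\<forall>\<pi>\<in>\<Phi>. \<forall>N as N' bs. (N, as) \<in> \<pi> \<longrightarrow> (N', bs) \<in> \<pi> \<longrightarrow> (\<forall>\<chi>\<in>F. holds N \<chi> as \<longleftrightarrow> holds N' \<chi> bs)"
      by (rule definable_partition_of_formulas[OF F F_fm])
    have "\<exists>h\<in>range Ms \<rightarrow>\<^sub>E UNIV. \<forall>(N, as)\<in>\<pi>. card (solutions \<phi> N n as) = h N" if \<pi>: "\<pi> \<in> \<Phi>" for \<pi>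
    proof
      \<comment> \<open>if no tuple of \<open>N\<close> belongs to \<open>\<pi>\<close>, the value is arbitrary\<close>
      let ?h = "\<lambda>N\<in>range Ms. card (solutions \<phi> N n (SOME as. (N, as) \<in> \<pi>))"
      show "?h \<in> range Ms \<rightarrow>\<^sub>E UNIV" by simp
      have \<pi>_sub: "\<pi> \<subseteq> pointed (range Ms) m"
        using \<Phi>(2) \<pi> unfolding definable_partition_def partition_on_def by blast
      have "card (solutions \<phi> N n as) = ?h N" if Nas: "(N, as) \<in> \<pi>" for N as
      proof -
        define bs where "bs = (SOME as. (N, as) \<in> \<pi>)"
        have Nbs: "(N, bs) \<in> \<pi>" unfolding bs_def by (rule someI[of "\<lambda>as. (N, as) \<in> \<pi>", OF Nas])
        obtain i where i: "N = Ms i" using \<pi>_sub Nas by (auto simp: pointed_def)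
        have "as \<in> tuples m (univ (Ms i))" "bs \<in> tuples m (univ (Ms i))"
          using \<pi>_sub Nas Nbs unfolding i pointed_def by blast+
        moreover have "\<forall>\<chi>\<in>F. holds (Ms i) \<chi> as \<longleftrightarrow> holds (Ms i) \<chi> bs"
          using \<Phi>(3)[rule_format, OF \<pi> Nas Nbs] unfolding i by blast
        ultimately show ?thesis using count[of as i bs] by (simp add: i bs_def)
      qed
      then show "\<forall>(N, as)\<in>\<pi>. card (solutions \<phi> N n as) = ?h N" by blast
    qed
    then show "\<exists>\<Phi>. finite \<Phi> \<and> definable_partition L (range Ms) m \<Phi> \<and>
        (\<forall>\<pi>\<in>\<Phi>. \<exists>h\<in>range Ms \<rightarrow>\<^sub>E UNIV. \<forall>(N, as)\<in>\<pi>. card (solutions \<phi> N n as) = h N)"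
      using \<Phi>(1,2) by blast
  qed
qed

end
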